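(* There exists a universal constant $c>0$ such that the following holds. For even $n$, let $A$ be the adjacency matrix of the two-community Stochastic Block Model on $n$ nodes with label vector $g\in\{\pm1\}^n$, $g^T\mathbf 1=0$, and connection probabilities $p>q$ (which may depend on $n$), and let $A^\natural=A-\frac{p+q}{2}\mathbf{1}\mathbf{1}^T$. If $$\tilde\lambda(p,q):=\frac{p-q}{\sqrt{2(p+q)}}\sqrt n\ \ge\ c\,n^{1/3},$$ then, with high probability, every second-order critical point $Q\in\mathbb{R}^{n\times2}$ of $$\max_{Q\in\mathbb{R}^{n\times2}}\operatorname{Tr}(Q^TA^\natural Q)\quad\text{s.t. }\|Q_{i:}\|_2^2=1,\ 1\le i\le n,$$ satisfies $QQ^T=gg^T$.
   Context: Stochastic Block Model on two communities: $n=2m$ nodes are split evenly into two communities, encoded by a fixed $g\in\{\pm1\}^n$ with $g^T\mathbf{1}=0$ ($\mathbf 1$ is the all-ones vector), and $0\le q<p\le1$. The random adjacency matrix $A$ is symmetric with independent entries $A_{ij}$, $i\le j$; $A_{ij}=1$ with probability $p$ and $0$ with probability $1-p$ if $g_ig_j=1$ (including the diagonal $i=j$), and $A_{ij}=1$ with probability $q$ and $0$ with probability $1-q$ if $g_ig_j=-1$. "With high probability" means with probability tending to $1$ as $n\to\infty$. $Q_{i:}$ denotes the $i$th row of $Q$. The operator $\mathrm{ddiag}$ maps a square matrix to the diagonal matrix obtained by setting all off-diagonal entries to zero; $\circ$ is the entrywise (Hadamard) product. For a symmetric cost matrix $M\in\mathbb{R}^{n\times n}$, a second-order critical point of $\max\{\operatorname{Tr}(Q^TMQ):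 Q\in\mathbb{R}^{n\times 2},\ \|Q_{i:}\|_2=1\ \forall i\}$ is a feasible $Q$ satisfying the first-order condition $(\mathrm{ddiag}(MQQ^T)-M)Q=0$ and the second-order condition $\mathrm{ddiag}(MQQ^T)-M\circ(QQ^T)\succeq 0$. *)

theory Defs
  imports "HOL-Probability.Product_PMF" "Jordan_Normal_Form.Matrix"
begin

unbundle no inner_syntax
unbundle no vec_syntax

definition ones_vec :: "nat \<Rightarrow> real Matrix.vec" where
  "ones_vec n = Matrix.vec n (\<lambda>_. 1)"

definition outer_prod :: "real Matrix.vec \<Rightarrow> real Matrix.vec \<Rightarrow> real mat" where
  "outer_prod u v = Matrix.mat (dim_vec u) (dim_vec v) (\<lambda>(i, j). u $ i * v $ j)"

definition ddiag :: "real mat \<Rightarrow> real mat" where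
  "ddiag M = Matrix.mat (dim_row M) (dim_col M) (\<lambda>(i, j). if i = j then M $$ (i, j) else 0)"

definition hadamard :: "real mat \<Rightarrow> real mat \<Rightarrow> real mat" where
  "hadamard M N = Matrix.mat (dim_row M) (dim_col M) (\<lambda>(i, j). M $$ (i, j) * N $$ (i, j))"

definition positive_semidefinite :: "real mat \<Rightarrow> bool" where
  "positive_semidefinite S \<longleftrightarrow>
     square_mat S \<and> transpose_mat S = S \<and>
     (\<forall>v \<in> carrier_vec (dim_row S). v \<bullet> (S *\<^sub>v v) \<ge> 0)"

definition balanced_labels :: "nat \<Rightarrow> real Matrix.vec \<Rightarrow> bool" where
  "balanced_labels n g \<longleftrightarrow>
     g \<in> carrier_vec n \<and> (\<forall>i<n. g $ i \<in> {1, -1}) \<and> g \<bullet> ones_vec n = 0"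

text \<open>
  The law of the adjacency matrix: independent edge indicators are drawn for the pairs
  \<open>i \<le> j\<close> (so also for the diagonal) and then symmetrised. Vertices are \<open>0, \<dots>, n - 1\<close>.
\<close>

definition sbm :: "nat \<Rightarrow> real Matrix.vec \<Rightarrow> real \<Rightarrow> real \<Rightarrow> real mat pmf" where
  "sbm n g p q =
     map_pmf (\<lambda>X. Matrix.mat n n (\<lambda>(i, j). of_bool (X (min i j, max i j))))
       (Pi_pmf {(i, j). i \<le> j \<and> j < n} False
          (\<lambda>(i, j). bernoulli_pmf (if g $ i * g $ j = 1 then p else q)))"

definition centered_adjacency :: "nat \<Rightarrow> real \<Rightarrow> real \<Rightarrow> real mat \<Rightarrow> real mat" where
  "centered_adjacency n p q A = A - ((p + q) / 2) \<cdot>\<^sub>m outer_prod (ones_vec n) (ones_vec n)"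

definition sbm_snr :: "nat \<Rightarrow> real \<Rightarrow> real \<Rightarrow> real" where
  "sbm_snr n p q = (p - q) / sqrt (2 * (p + q)) * sqrt (real n)"

text \<open>
  Feasibility, first-order and second-order conditions for maximising \<open>Tr (Q\<^sup>T M Q)\<close>
  over \<open>n \<times> 2\<close> matrices \<open>Q\<close> with rows of unit Euclidean norm, where \<open>M\<close> is symmetric.
\<close>

definition feasible :: "nat \<Rightarrow> real mat \<Rightarrow> bool" where
  "feasible n Q \<longleftrightarrow> Q \<in> carrier_mat n 2 \<and> (\<forall>i<n. row Q i \<bullet> row Q i = 1)"

definition second_order_critical :: "nat \<Rightarrow> real mat \<Rightarrow> real mat \<Rightarrow> bool" where
  "second_order_critical n M Q \<longleftrightarrow>
     feasible n Q \<and>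
     (ddiag (M * Q * transpose_mat Q) - M) * Q = 0\<^sub>m n 2 \<and>
     positive_semidefinite
       (ddiag (M * Q * transpose_mat Q) - hadamard M (Q * transpose_mat Q))"

end

theory Submission
  imports Defs "HOL-Real_Asymp.Real_Asymp"
begin

text \<open>
  After conjugation by \<open>g\<close> the cost matrix is \<open>a 1 1\<^sup>T + W\<close> with centred noise \<open>W\<close>.
  Testing the second-order condition against the columns of \<open>Q\<close>, and combining it with the first-order
  condition, shows that the mean row of \<open>Q\<close> has squared norm \<open>1 - O(n\<^bsup>-1/3\<^esup>)\<close>.
  These steps see the noise only through \<open>v\<^sup>T W w\<close> with \<open>v, w \<in> [-1, 1]\<^sup>n\<close>,
  which a Chernoff bound and a union over sign vectors control without logarithmic loss.
  The rows of \<open>W Q\<close> are then uniformly small (this is where \<open>n\<^bsup>1/3\<^esup>\<close> is needed),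
  so every diagonal entry of \<open>S = ddiag (M Q Q\<^sup>T)\<close> is at least \<open>a n / 2\<close>.
  The component \<open>u\<close> of \<open>Q\<close> orthogonal to the mean row satisfies \<open>1\<^sup>T u = 0\<close>, hence
  \<open>S u = W u\<close>, and \<open>u = 0\<close> follows as soon as the spectral norm of \<open>W\<close> is below \<open>a n / 2\<close>.
  For that the crude bound \<open>O(n\<^bsup>5/6\<^esup> (p + q)\<^bsup>1/2\<^esup>)\<close> suffices, which only needs the
  second moment of the off-diagonal part of \<open>W\<^sup>2\<close>.
\<close>

section \<open>Critical points for bounded noise\<close>

text \<open>The form is linear in each argument separately, so over the cube it is maximised at
  vertices: \<open>v\<close> is rounded to signs with \<open>w\<close> fixed, then \<open>w\<close>
  with \<open>s\<close> fixed. A bound over the whole cube thus reduces to finitely many sign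
  pairs.\<close>

lemma ex_sign_vector_cut_max:
  fixes W :: "nat \<Rightarrow> nat \<Rightarrow> real"
  assumes v: "\<forall>i<n. \<bar>v i\<bar> \<le> 1" and w: "\<forall>i<n. \<bar>w i\<bar> \<le> 1"
  shows "\<exists>s t. (\<forall>i. s i \<in> {-1, 1}) \<and> (\<forall>i. t i \<in> {-1, 1}) \<and>
    (\<Sum>i<n. \<Sum>j<n. W i j * v i * w j) \<le> (\<Sum>i<n. \<Sum>j<n. W i j * s i * t j)"
proof -
  have round: "\<exists>s. (\<forall>i. s i \<in> {-1, 1}) \<and> (\<Sum>i<n. f i * u i) \<le> (\<Sum>i<n. f i * s i)"
    if "\<forall>i<n. \<bar>u i\<bar> \<le> 1" for f u :: "nat \<Rightarrow> real"
  proof (intro exI conjI allI sum_mono)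
    fix i assume "i \<in> {..<n}"
    have "f i * u i \<le> \<bar>f i\<bar> * \<bar>u i\<bar>" by (metis abs_ge_self abs_mult)
    also have "\<dots> \<le> \<bar>f i\<bar>" using that \<open>i \<in> _\<close> by (simp add: mult_left_le)
    also have "\<dots> = f i * (if f i \<ge> 0 then 1 else -1)" by simp
    finally show "f i * u i \<le> f i * (if f i \<ge> 0 then 1 else -1)" .
  qed auto
  obtain s where s: "\<forall>i. s i \<in> {-1, 1}"
    "(\<Sum>i<n. (\<Sum>j<n. W i j * w j) * v i) \<le> (\<Sum>i<n. (\<Sum>j<n. W i j * w j) * s i)"
    using round[OF v, of "\<lambda>i. \<Sum>j<n. W i j * w j"] by blast
  obtain t where t: "\<forall>i. t i \<in> {-1, 1}"
    "(\<Sum>j<n. (\<Sum>i<n. W i j * s i) * w j) \<le> (\<Sum>j<n. (\<Sum>i<n. W i j * s i) * t j)"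
    using round[OF w, of "\<lambda>j. \<Sum>i<n. W i j * s i"] by blast
  have swap: "(\<Sum>j<n. (\<Sum>i<n. W i j * s i) * r j) = (\<Sum>i<n. \<Sum>j<n. W i j * s i * r j)" for r
    unfolding sum_distrib_right by (rule sum.swap)
  have "(\<Sum>i<n. \<Sum>j<n. W i j * v i * w j) = (\<Sum>i<n. (\<Sum>j<n. W i j * w j) * v i)"
    unfolding sum_distrib_right by (intro sum.cong refl) (simp add: mult_ac)
  also have "\<dots> \<le> (\<Sum>i<n. (\<Sum>j<n. W i j * w j) * s i)" by (rule s)
  also have "\<dots> = (\<Sum>j<n. (\<Sum>i<n. W i j * s i) * w j)"
    unfolding swap unfolding sum_distrib_right by (intro sum.cong refl) (simp add: mult_ac)
  also have "\<dots> \<le> (\<Sum>i<n. \<Sum>j<n. W i j * s i * t j)"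
    using t(2) unfolding swap .
  finally show ?thesis using s(1) t(1) by blast
qed

text \<open>The left side is the quadratic form of the Gram matrix of the rows of \<open>W\<close>.
  Its diagonal contributes at most \<open>d\<close>, its off-diagonal part at most its Frobenius
  norm, a cheap substitute for the spectral norm.\<close>

lemma norm_mult_vec_le_of_gram:
  fixes W :: "nat \<Rightarrow> nat \<Rightarrow> real"
  assumes diag: "\<And>j. j < n \<Longrightarrow> (\<Sum>i<n. (W j i)\<^sup>2) \<le> d"
    and offdiag: "(\<Sum>j<n. \<Sum>k\<in>{..<n}-{j}. (\<Sum>i<n. W j i * W k i)\<^sup>2) \<le> b\<^sup>2" and "0 \<le> b"
  shows "(\<Sum>i<n. (\<Sum>j<n. W j i * u j)\<^sup>2) \<le> (d + b) * (\<Sum>j<n. (u j)\<^sup>2)"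
proof -
  define G where "G j k = (\<Sum>i<n. W j i * W k i)" for j k
  let ?U = "\<Sum>j<n. (u j)\<^sup>2"
  have U0: "0 \<le> ?U" by (simp add: sum_nonneg)
  have "(\<Sum>i<n. (\<Sum>j<n. W j i * u j)\<^sup>2)
      = (\<Sum>i<n. \<Sum>j<n. \<Sum>k<n. (W j i * u j) * (W k i * u k))"
    by (simp add: power2_eq_square sum_product)
  also have "\<dots> = (\<Sum>j<n. \<Sum>i<n. \<Sum>k<n. (W j i * u j) * (W k i * u k))"
    by (rule sum.swap)
  also have "\<dots> = (\<Sum>j<n. \<Sum>k<n. \<Sum>i<n. (W j i * u j) * (W k i * u k))"
    by (intro sum.cong refl sum.swap)
  also have "\<dots> = (\<Sum>j<n. \<Sum>k<n. u j * u k * G j k)"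
    by (simp add: G_def sum_distrib_left mult_ac)
  also have "\<dots> = (\<Sum>j<n. u j * u j * G j j + (\<Sum>k\<in>{..<n}-{j}. u j * u k * G j k))"
    by (intro sum.cong refl sum.remove) auto
  also have "\<dots> = (\<Sum>j<n. u j * u j * G j j) + (\<Sum>j<n. \<Sum>k\<in>{..<n}-{j}. u j * u k * G j k)"
    by (rule sum.distrib)
  finally have split: "(\<Sum>i<n. (\<Sum>j<n. W j i * u j)\<^sup>2) = \<dots>" .
  have "(\<Sum>j<n. u j * u j * G j j) \<le> (\<Sum>j<n. d * (u j)\<^sup>2)"
  proof (rule sum_mono)
    fix j assume "j \<in> {..<n}"
    then have "G j j \<le> d" using diag[of j] by (simp add: G_def power2_eq_square)
    then show "u j * u j * G j j \<le> d * (u j)\<^sup>2"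
      by (metis mult.commute mult_right_mono power2_eq_square zero_le_power2)
  qed
  then have 1: "(\<Sum>j<n. u j * u j * G j j) \<le> d * ?U" by (simp add: sum_distrib_left)
  let ?I = "SIGMA j:{..<n}. {..<n}-{j}"
  \<comment> \<open>Cauchy-Schwarz over the pairs \<open>j \<noteq> k\<close>; adding the pairs
    \<open>j = k\<close> bounds the first factor by \<open>?U\<^sup>2\<close>.\<close>
  have "(\<Sum>j<n. \<Sum>k\<in>{..<n}-{j}. u j * u k * G j k)\<^sup>2
      = (\<Sum>(j,k)\<in>?I. (u j * u k) * G j k)\<^sup>2"
    by (subst sum.Sigma) auto
  also have "\<dots> \<le> (\<Sum>(j,k)\<in>?I. (u j * u k)\<^sup>2) * (\<Sum>(j,k)\<in>?I. (G j k)\<^sup>2)"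
    using Cauchy_Schwarz_ineq_sum[of "\<lambda>(j,k). u j * u k" "\<lambda>(j,k). G j k" ?I]
    by (simp add: case_prod_unfold)
  also have "\<dots> \<le> ?U\<^sup>2 * b\<^sup>2"
  proof (rule mult_mono)
    have "(\<Sum>(j,k)\<in>?I. (u j * u k)\<^sup>2) \<le> (\<Sum>(j,k)\<in>{..<n}\<times>{..<n}. (u j * u k)\<^sup>2)"
      by (rule sum_mono2) auto
    also have "\<dots> = ?U\<^sup>2"
      by (simp add: sum.cartesian_product[symmetric] power_mult_distrib power2_eq_square[of ?U] sum_product)
    finally show "(\<Sum>(j,k)\<in>?I. (u j * u k)\<^sup>2) \<le> ?U\<^sup>2" .
    have "(\<Sum>(j,k)\<in>?I. (G j k)\<^sup>2) = (\<Sum>j<n. \<Sum>k\<in>{..<n}-{j}. (G j k)\<^sup>2)"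
      by (subst sum.Sigma) auto
    then show "(\<Sum>(j,k)\<in>?I. (G j k)\<^sup>2) \<le> b\<^sup>2" using offdiag by (simp add: G_def)
  qed (auto intro!: sum_nonneg)
  finally have "(\<Sum>j<n. \<Sum>k\<in>{..<n}-{j}. u j * u k * G j k)\<^sup>2 \<le> (?U * b)\<^sup>2"
    by (simp add: power_mult_distrib)
  then have "(\<Sum>j<n. \<Sum>k\<in>{..<n}-{j}. u j * u k * G j k) \<le> ?U * b"
    using U0 \<open>0 \<le> b\<close> by (auto elim: power2_le_imp_le)
  with 1 split show ?thesis by (simp only: distrib_right mult.commute[of b])
qed

text \<open>
  Rescaling row \<open>i\<close> of \<open>Q\<close> by \<open>g\<^sub>i\<close> turns the planted matrix into
  \<open>a 1 1\<^sup>T\<close>. Here \<open>(x i, y i)\<close> is the rescaled row, \<open>W\<close> the rescaled noise,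
  \<open>a = (p - q) / 2\<close>, \<open>L = n\<^bsup>1/3\<^esup>\<close> and \<open>h\<^sup>2 = n (p + q)\<close>.
\<close>

locale planted_critical_point =
  fixes n :: nat and a h L N :: real and W :: "nat \<Rightarrow> nat \<Rightarrow> real" and x y S :: "nat \<Rightarrow> real"
  assumes N: "N = real n" and L: "L ^ 3 = N" "1 \<le> L" and h: "0 < h"
    and snr: "1000 * L * h \<le> a * N" and large: "2 \<le> a * N"
    and sym: "W i j = W j i"
    and cut: "\<And>v w. \<lbrakk>\<forall>i<n. \<bar>v i\<bar> \<le> 1; \<forall>i<n. \<bar>w i\<bar> \<le> 1\<rbrakk>
      \<Longrightarrow> (\<Sum>i<n. \<Sum>j<n. W i j * v i * w j) \<le> 7 * N * h"
    and row_sum: "i < n \<Longrightarrow> \<bar>\<Sum>j<n. W i j\<bar> \<le> L * h"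
    and row_norm: "i < n \<Longrightarrow> (\<Sum>j<n. (W i j)\<^sup>2) \<le> 3 * h\<^sup>2"
    and gram: "(\<Sum>i<n. \<Sum>k\<in>{..<n}-{i}. (\<Sum>j<n. W i j * W k j)\<^sup>2) \<le> (L\<^sup>2 * h\<^sup>2)\<^sup>2"
    and diag: "i < n \<Longrightarrow> -1 \<le> a + W i i"
    and unit: "i < n \<Longrightarrow> (x i)\<^sup>2 + (y i)\<^sup>2 = 1"
    and S: "i < n \<Longrightarrow> S i = (\<Sum>j<n. (a + W i j) * (x i * x j + y i * y j))"
    and first_order: "i < n \<Longrightarrow> S i * x i = (\<Sum>j<n. (a + W i j) * x j)"
      "i < n \<Longrightarrow> S i * y i = (\<Sum>j<n. (a + W i j) * y j)"
    and second_order: "\<And>v. (\<Sum>i<n. \<Sum>j<n. (a + W i j) * (x i * x j + y i * y j) * v i * v j)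
      \<le> (\<Sum>i<n. S i * (v i)\<^sup>2)"
begin

section \<open>The planar configuration of rescaled rows\<close>

text \<open>\<open>(\<alpha>, \<beta>)\<close> is \<open>N\<close> times the mean row and
  \<open>D\<close> its squared length; for unit rows \<open>D = N\<^sup>2\<close> exactly when all
  rows agree.\<close>

definition "\<alpha> = (\<Sum>i<n. x i)"
definition "\<beta> = (\<Sum>i<n. y i)"
definition "D = \<alpha>\<^sup>2 + \<beta>\<^sup>2"
text \<open>The planar cross product of the summed row with row \<open>i\<close>:
  \<open>sqrt D\<close> times the signed component of that row orthogonal to the mean row.\<close>

definition "u i = \<alpha> * y i - \<beta> * x i"
definition "Wx i = (\<Sum>j<n. W i j * x j)"
definition "Wy i = (\<Sum>j<n. W i j * y j)"
definition "xx = (\<Sum>i<n. (x i)\<^sup>2)"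
definition "yy = (\<Sum>i<n. (y i)\<^sup>2)"
definition "xy = (\<Sum>i<n. x i * y i)"
text \<open>The squared Frobenius norm of the 2 x 2 matrix with entries \<open>xx\<close>,
  \<open>xy\<close>, \<open>yy\<close>; equally, the sum of squared inner products over all pairs of
  rows.\<close>

definition "Q2 = xx\<^sup>2 + yy\<^sup>2 + 2 * xy\<^sup>2"

lemma n_pos: "0 < N"
proof -
  have "0 < L^3" using L(2) by simp
  then show ?thesis using L(1) by simp
qed

lemma a_pos: "0 < a"
  using n_pos large zero_less_mult_pos2[of a N] by linarith

text \<open>The signal-to-noise hypothesis in the shape used with \<open>cut\<close>: an error
  \<open>7 * N * h\<close> costs a fraction of order \<open>1 / L\<close> of the signal
  \<open>a * N\<^sup>2\<close>.\<close>

lemma nh: "N * h \<le> a * N\<^sup>2 / (1000 * L)"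
proof -
  have "1000 * L * h * N \<le> a * N * N" using snr n_pos by (intro mult_right_mono) auto
  then show ?thesis using L(2) by (simp add: field_simps power2_eq_square)
qed

lemma x_le: "i < n \<Longrightarrow> \<bar>x i\<bar> \<le> 1" and y_le: "i < n \<Longrightarrow> \<bar>y i\<bar> \<le> 1"
  using unit[of i] zero_le_power2[of "x i"] zero_le_power2[of "y i"]
  unfolding abs_square_le_1[symmetric] by linarith+

lemma xx_yy: "xx + yy = N"
  unfolding xx_def yy_def sum.distrib[symmetric] using unit N by simp

lemma sum_sq_le: "\<alpha>\<^sup>2 \<le> xx * N" "\<beta>\<^sup>2 \<le> yy * N"
  unfolding \<alpha>_def \<beta>_def xx_def yy_def
  using Cauchy_Schwarz_ineq_sum[of x "\<lambda>_. 1" "{..<n}"]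
    Cauchy_Schwarz_ineq_sum[of y "\<lambda>_. 1" "{..<n}"] N by auto

lemma D_le: "D \<le> N\<^sup>2"
proof -
  have "D \<le> (xx + yy) * N" unfolding D_def distrib_right using sum_sq_le by (rule add_mono)
  then show ?thesis unfolding xx_yy power2_eq_square .
qed

lemma first_order_x: "i < n \<Longrightarrow> S i * x i = a * \<alpha> + Wx i"
  and first_order_y: "i < n \<Longrightarrow> S i * y i = a * \<beta> + Wy i"
  by (simp_all add: first_order \<alpha>_def \<beta>_def Wx_def Wy_def algebra_simps sum.distrib sum_distrib_left)

section \<open>Lower bound for the length of the summed row\<close>

lemma cut_sq:
  assumes "\<And>i. i < n \<Longrightarrow> \<bar>v i\<bar> \<le> 1"
  shows "(\<Sum>i<n. \<Sum>j<n. W i j * (v i * v j)) \<le> 7 * N * h"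
    "- (\<Sum>i<n. \<Sum>j<n. W i j * (v i * v j)) \<le> 7 * N * h"
proof -
  show "(\<Sum>i<n. \<Sum>j<n. W i j * (v i * v j)) \<le> 7 * N * h"
    using cut[of v v] assms by (simp add: mult_ac)
  show "- (\<Sum>i<n. \<Sum>j<n. W i j * (v i * v j)) \<le> 7 * N * h"
    using cut[of v "\<lambda>i. - v i"] assms by (simp add: mult_ac sum_negf)
qed

text \<open>Adds the second-order conditions with the two columns of \<open>Q\<close> as test vectors.\<close>

lemma D_ge_Q2: "Q2 - 42 * N\<^sup>2 / (1000 * L) \<le> D"
proof -
  let ?X = "\<lambda>i j. x i * x j + y i * y j"
  have eq: "(\<Sum>i<n. \<Sum>j<n. (a + W i j) * (?X i j)\<^sup>2) =
     (\<Sum>i<n. \<Sum>j<n. (a + W i j) * ?X i j * x i * x j) + (\<Sum>i<n. \<Sum>j<n. (a + W i j) * ?X i j * y i * y j)"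
    unfolding sum.distrib[symmetric] by (intro sum.cong refl) (simp add: power2_eq_square algebra_simps)
  also have "\<dots> \<le> (\<Sum>i<n. S i * (x i)\<^sup>2) + (\<Sum>i<n. S i * (y i)\<^sup>2)"
    by (intro add_mono second_order)
  also have "\<dots> = (\<Sum>i<n. S i * ((x i)\<^sup>2 + (y i)\<^sup>2))"
    unfolding sum.distrib[symmetric] by (simp add: algebra_simps)
  also have "\<dots> = (\<Sum>i<n. \<Sum>j<n. (a + W i j) * ?X i j)"
    by (intro sum.cong refl) (simp add: unit S)
  finally have main: "(\<Sum>i<n. \<Sum>j<n. (a + W i j) * (?X i j)\<^sup>2) \<le> (\<Sum>i<n. \<Sum>j<n. (a + W i j) * ?X i j)" .
  have p: "(\<Sum>i<n. \<Sum>j<n. f i * f j) = (\<Sum>i<n. f i)\<^sup>2" for f :: "nat \<Rightarrow> real"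
    by (simp add: power2_eq_square sum_product)
  \<comment> \<open>\<open>A\<close> and \<open>B\<close> are the noise corrections to the noiseless
    inequality \<open>a * Q2 \<le> a * D\<close>. They consist of two and, with multiplicity, four
    forms of size at most \<open>7 * N * h\<close>, whence 14 + 28 = 42.\<close>
  define A where "A = (\<Sum>i<n. \<Sum>j<n. W i j * (x i * x j)) + (\<Sum>i<n. \<Sum>j<n. W i j * (y i * y j))"
  define B where "B = (\<Sum>i<n. \<Sum>j<n. W i j * ((x i)\<^sup>2 * (x j)\<^sup>2)) + (\<Sum>i<n. \<Sum>j<n. W i j * ((y i)\<^sup>2 * (y j)\<^sup>2))
     + 2 * (\<Sum>i<n. \<Sum>j<n. W i j * ((x i * y i) * (x j * y j)))"
  have "(\<Sum>i<n. \<Sum>j<n. (a + W i j) * ?X i j) = a * ((\<Sum>i<n. \<Sum>j<n. x i * x j) + (\<Sum>i<n. \<Sum>j<n. y i * y j)) + A"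
    unfolding A_def sum.distrib[symmetric] sum_distrib_left by (intro sum.cong refl) (simp add: algebra_simps)
  then have e1: "(\<Sum>i<n. \<Sum>j<n. (a + W i j) * ?X i j) = a * D + A"
    unfolding p D_def \<alpha>_def \<beta>_def .
  have "(\<Sum>i<n. \<Sum>j<n. (a + W i j) * (?X i j)\<^sup>2) = a * ((\<Sum>i<n. \<Sum>j<n. (x i)\<^sup>2 * (x j)\<^sup>2) + (\<Sum>i<n. \<Sum>j<n. (y i)\<^sup>2 * (y j)\<^sup>2)
      + 2 * (\<Sum>i<n. \<Sum>j<n. (x i * y i) * (x j * y j))) + B"
    unfolding B_def sum.distrib[symmetric] sum_distrib_left
    by (intro sum.cong refl) (simp add: algebra_simps power2_eq_square)
  then have e2: "(\<Sum>i<n. \<Sum>j<n. (a + W i j) * (?X i j)\<^sup>2) = a * Q2 + B"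
    unfolding p Q2_def xx_def yy_def xy_def .
  have "A \<le> 14 * N * h" using cut_sq(1)[of x] cut_sq(1)[of y] x_le y_le unfolding A_def by simp
  moreover have "- B \<le> 28 * N * h"
    using cut_sq(2)[of "\<lambda>i. (x i)\<^sup>2"] cut_sq(2)[of "\<lambda>i. (y i)\<^sup>2"] cut_sq(2)[of "\<lambda>i. x i * y i"] x_le y_le
    unfolding B_def by (simp add: abs_mult abs_square_le_1 mult_le_one)
  ultimately have "a * Q2 \<le> a * D + 42 * (N * h)" using main e1 e2 by linarith
  also have "\<dots> \<le> a * D + 42 * (a * N\<^sup>2 / (1000 * L))" using nh by simp
  also have "\<dots> = a * (D + 42 * N\<^sup>2 / (1000 * L))" by (simp add: algebra_simps)
  finally show ?thesis using a_pos by simp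
qed

lemma div_L: "0 \<le> z \<Longrightarrow> z / L \<le> z"
  using L(2) by (simp add: divide_le_eq mult_right_le_one_le mult_le_cancel_left1)

text \<open>A crude first bound from \<open>xx + yy = N\<close>, which forces
  \<open>Q2 \<ge> N\<^sup>2 / 2\<close>. It makes \<open>D\<close> comparable to
  \<open>N\<^sup>2\<close>, so that \<open>D_ge\<close> can measure errors relative to
  \<open>D\<close>.\<close>

lemma D_ge_quarter: "N\<^sup>2 / 4 \<le> D"
proof -
  have "N ^ 2 / 2 \<le> xx\<^sup>2 + yy\<^sup>2"
    using sum_squares_ge_zero[of "xx - yy" 0] xx_yy[symmetric] by (simp add: power2_eq_square algebra_simps)
  moreover have "0 \<le> xy\<^sup>2" by simp
  moreover have "42 * N\<^sup>2 / (1000 * L) \<le> 42 * N\<^sup>2 / 1000"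
    using div_L[of "42 * N\<^sup>2 / 1000"] by simp
  moreover have "0 \<le> N\<^sup>2" by simp
  ultimately show ?thesis using D_ge_Q2 unfolding Q2_def by linarith
qed

lemma D_pos: "0 < D"
  using D_ge_quarter zero_less_power[OF n_pos, of 2] by linarith

text \<open>Eliminating \<open>S i\<close> from the two first-order equations leaves
  \<open>a * u i = x i * Wy i - y i * Wx i\<close>, so \<open>u\<close> is driven by noise alone.
  Pairing this with \<open>u / N\<close> produces two cut forms.\<close>

lemma sum_u_sq: "(\<Sum>i<n. (u i)\<^sup>2) \<le> 14 * N ^ 3 / (1000 * L)"
proof -
  have n0: "N \<noteq> 0" using n_pos by simp
  have u_le: "\<bar>u i / N\<bar> \<le> 1" if "i < n" for i
  proof -
    \<comment> \<open>The squared cross and inner products with the summed row add up to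
      \<open>D\<close>, which is at most \<open>N\<^sup>2\<close>; hence \<open>u / N\<close> is
      admissible in \<open>cut\<close>.\<close>
    have "(u i)\<^sup>2 + (\<alpha> * x i + \<beta> * y i)\<^sup>2 = D * ((x i)\<^sup>2 + (y i)\<^sup>2)"
      unfolding u_def D_def by (simp add: power2_eq_square algebra_simps)
    then have "(u i)\<^sup>2 \<le> (N)\<^sup>2" using D_le unit[OF that] zero_le_power2[of "\<alpha> * x i + \<beta> * y i"]
      by (simp only: mult_1_right)
    then show ?thesis using n_pos by (simp add: abs_le_square_iff[symmetric])
  qed
  have "a * u i = x i * Wy i - y i * Wx i" if "i < n" for i
  proof -
    have "y i * (S i * x i) = x i * (S i * y i)" by simp
    then show ?thesis unfolding first_order_x[OF that] first_order_y[OF that] u_def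
      by (simp add: algebra_simps)
  qed
  then have "(\<Sum>i<n. u i / N * (a * u i)) = (\<Sum>i<n. u i / N * (x i * Wy i - y i * Wx i))" by simp
  also have "\<dots> = (\<Sum>i<n. \<Sum>j<n. W i j * (u i / N * x i) * y j)
     + (\<Sum>i<n. \<Sum>j<n. W i j * (u i / N * y i) * (- x j))"
    unfolding Wx_def Wy_def sum.distrib[symmetric] sum_subtractf[symmetric] sum_distrib_left
    by (intro sum.cong refl) (simp add: algebra_simps diff_divide_distrib)
  also have "\<dots> \<le> 7 * N * h + 7 * N * h"
    using u_le x_le y_le by (intro add_mono cut) (auto simp: abs_mult simp del: abs_divide times_divide_eq_left intro!: mult_le_one)
  also have "\<dots> \<le> 14 * (a * N\<^sup>2 / (1000 * L))" using nh by linarith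
  finally have "N * a * (\<Sum>i<n. u i / N * (a * u i)) \<le> N * a * (14 * (a * N\<^sup>2 / (1000 * L)))"
    using n_pos a_pos by (intro mult_left_mono) auto
  moreover have "(\<Sum>i<n. u i / N * (a * u i)) = a / N * (\<Sum>i<n. (u i)\<^sup>2)"
    unfolding sum_distrib_left by (simp add: power2_eq_square mult_ac)
  moreover have "N * a * (a / N * z) = a^2 * z" for z using n0 by (simp add: power2_eq_square)
  moreover have "N * a * (14 * (a * N\<^sup>2 / (1000 * L))) = a^2 * (14 * N ^ 3 / (1000 * L))"
    by (simp add: power2_eq_square power3_eq_cube mult_ac)
  ultimately have "a^2 * (\<Sum>i<n. (u i)\<^sup>2) \<le> a^2 * (14 * N ^ 3 / (1000 * L))"
    by metis
  then show ?thesis using a_pos by (simp only: mult_le_cancel_left_pos zero_less_power)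
qed

text \<open>Small \<open>u\<close> means that the rows nearly align with the mean row up to sign.
  The matrix of \<open>xx\<close>, \<open>xy\<close>, \<open>yy\<close> then has trace
  \<open>N\<close> and is nearly of rank one, so \<open>Q2\<close> is close to
  \<open>N\<^sup>2\<close>, and \<open>D_ge_Q2\<close> passes this on to \<open>D\<close>.\<close>

lemma D_ge: "N\<^sup>2 * (1 - 154 / (1000 * L)) \<le> D"
proof -
  let ?U = "\<Sum>i<n. (u i)\<^sup>2"
  let ?e = "56 / (1000 * L)"
  \<comment> \<open>Trading \<open>N\<^sup>2\<close> for \<open>4 * D\<close> turns the 14 of
    \<open>sum_u_sq\<close> into 56.\<close>
  have "?U \<le> N\<^sup>2 / 4 * (N * ?e)" using sum_u_sq by (simp add: power2_eq_square power3_eq_cube)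
  also have "\<dots> \<le> D * (N * ?e)" using D_ge_quarter L(2) n_pos by (intro mult_right_mono) auto
  finally have U: "?U \<le> D * (N * ?e)" .
  have q: "\<alpha>\<^sup>2 * xx + 2 * (\<alpha> * \<beta>) * xy + \<beta>\<^sup>2 * yy = D * N - ?U"
  proof -
    have "?U = (\<Sum>i<n. \<alpha>\<^sup>2 * (y i)\<^sup>2 + (\<beta>\<^sup>2 * (x i)\<^sup>2 - 2 * (\<alpha> * \<beta>) * (x i * y i)))"
      unfolding u_def by (simp add: power2_eq_square algebra_simps)
    also have "\<dots> = \<alpha>\<^sup>2 * yy + (\<beta>\<^sup>2 * xx - 2 * (\<alpha> * \<beta>) * xy)"
      unfolding xx_def yy_def xy_def by (simp add: sum.distrib sum_subtractf sum_distrib_left)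
    finally show ?thesis unfolding D_def xx_yy[symmetric] by (simp add: algebra_simps)
  qed
  have e1: "?e \<le> 1" "0 \<le> ?e" using L(2) by auto
  have "D * (N * (1 - ?e)) \<le> D * N - ?U" using U by (simp add: algebra_simps)
  moreover have "0 \<le> D * (N * (1 - ?e))" using D_pos e1 n_pos by (intro mult_nonneg_nonneg) auto
  ultimately have "(D * (N * (1 - ?e)))\<^sup>2 \<le> (\<alpha>\<^sup>2 * xx + 2 * (\<alpha> * \<beta>) * xy + \<beta>\<^sup>2 * yy)\<^sup>2"
    unfolding q by (rule power_mono)
  \<comment> \<open>Cauchy-Schwarz for the Frobenius inner product of the matrix of
    \<open>xx\<close>, \<open>xy\<close>, \<open>yy\<close> with the rank-one matrix of
    \<open>(\<alpha>, \<beta>)\<close>, whose norm is \<open>D\<close>; the defect is written out by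
    Lagrange's identity.\<close>
  also have "\<dots> \<le> D\<^sup>2 * Q2"
  proof -
    have "D\<^sup>2 * Q2 - (\<alpha>\<^sup>2 * xx + 2 * (\<alpha> * \<beta>) * xy + \<beta>\<^sup>2 * yy)\<^sup>2
      = (\<alpha>\<^sup>2 * yy - \<beta>\<^sup>2 * xx)\<^sup>2 + 2 * (\<alpha>\<^sup>2 * xy - \<alpha> * \<beta> * xx)\<^sup>2 + 2 * (\<beta>\<^sup>2 * xy - \<alpha> * \<beta> * yy)\<^sup>2"
      unfolding D_def Q2_def by (simp add: power2_eq_square algebra_simps)
    moreover have "0 \<le> \<dots>" by simp
    ultimately show ?thesis by linarith
  qed
  finally have "D\<^sup>2 * (N * (1 - ?e))\<^sup>2 \<le> D\<^sup>2 * Q2" by (simp add: power_mult_distrib)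
  then have Q2: "N\<^sup>2 * (1 - ?e)\<^sup>2 \<le> Q2" using D_pos by (simp add: power_mult_distrib)
  \<comment> \<open>Linearising the square costs 2 * 56, and \<open>D_ge_Q2\<close> adds 42: this is
    the 154.\<close>
  have "(1 - ?e)\<^sup>2 = 1 - 2 * ?e + ?e\<^sup>2" by (simp add: power2_diff)
  then have "1 - 2 * ?e \<le> (1 - ?e)\<^sup>2" by simp
  then have "N\<^sup>2 * (1 - 2 * ?e) \<le> N\<^sup>2 * (1 - ?e)\<^sup>2" by (rule mult_left_mono) simp
  with Q2 have "N\<^sup>2 * (1 - 2 * ?e) - 42 * N\<^sup>2 / (1000 * L) \<le> D" using D_ge_Q2 by linarith
  then show ?thesis by (simp add: algebra_simps)
qed

lemma D_ge': "N\<^sup>2 * (846 / 1000) \<le> D"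
proof -
  have "154 / (1000 * L) \<le> 154 / 1000" using L(2) by (intro divide_left_mono) auto
  then have "N\<^sup>2 * (846 / 1000) \<le> N\<^sup>2 * (1 - 154 / (1000 * L))" by (intro mult_left_mono) auto
  then show ?thesis using D_ge by linarith
qed

section \<open>Uniform row bounds and collapse of the rows\<close>

text \<open>Split \<open>z\<close> into mean and deviation. The mean part is controlled by the row
  sum of \<open>W\<close>. By \<open>D_ge\<close> the deviation has squared norm of order
  \<open>N / L\<close>, which equals \<open>L\<^sup>2\<close> precisely because
  \<open>L ^ 3 = N\<close>; Cauchy-Schwarz with \<open>row_norm\<close> then gives
  \<open>L * h\<close> again.\<close>

lemma row_product_le:
  assumes i: "i < n" and z: "(\<Sum>j<n. z j)\<^sup>2 \<le> N\<^sup>2" and dev: "(\<Sum>j<n. (z j)\<^sup>2) - (\<Sum>j<n. z j)\<^sup>2 / N \<le> N - D / N"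
  shows "\<bar>\<Sum>j<n. W i j * z j\<bar> \<le> a * N / 500"
proof -
  define s where "s = (\<Sum>j<n. z j)"
  have n0: "N \<noteq> 0" using n_pos by simp
  have "(\<Sum>j<n. (z j - s / N)\<^sup>2) = (\<Sum>j<n. (z j)\<^sup>2 - 2 * (s / N) * z j + (s / N)\<^sup>2)"
    by (simp add: power2_diff algebra_simps)
  also have "\<dots> = (\<Sum>j<n. (z j)\<^sup>2) - 2 * (s / N) * s + N * (s / N)\<^sup>2"
    unfolding s_def N by (simp add: sum.distrib sum_subtractf sum_distrib_left)
  also have "\<dots> = (\<Sum>j<n. (z j)\<^sup>2) - s\<^sup>2 / N" using n0 by (simp add: power2_eq_square field_simps)
  also have "\<dots> \<le> N - D / N" using dev unfolding s_def .
  also have "\<dots> \<le> N - N * (1 - 154 / (1000 * L))"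
    using D_ge n_pos by (simp add: le_divide_eq power2_eq_square mult_ac)
  also have "\<dots> = 154 / 1000 * (N / L)" by (simp add: algebra_simps)
  also have "\<dots> = 154 / 1000 * L\<^sup>2" using L by (simp flip: L(1) add: power2_eq_square power3_eq_cube)
  finally have dev': "(\<Sum>j<n. (z j - s / N)\<^sup>2) \<le> 154 / 1000 * L\<^sup>2" .
  have "(\<Sum>j<n. W i j * (z j - s / N))\<^sup>2 \<le> (\<Sum>j<n. (W i j)\<^sup>2) * (\<Sum>j<n. (z j - s / N)\<^sup>2)"
    by (rule Cauchy_Schwarz_ineq_sum)
  also have "\<dots> \<le> (3 * h\<^sup>2) * (154 / 1000 * L\<^sup>2)"
    by (intro mult_mono row_norm i dev' sum_nonneg) auto
  also have "\<dots> \<le> (L * h)\<^sup>2" by (simp add: power_mult_distrib)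
  finally have 1: "\<bar>\<Sum>j<n. W i j * (z j - s / N)\<bar> \<le> L * h"
    using L(2) h by (simp add: abs_le_square_iff[symmetric])
  have "\<bar>s / N\<bar> \<le> 1" using z n_pos unfolding s_def by (simp add: abs_le_square_iff[symmetric])
  then have "\<bar>s / N * (\<Sum>j<n. W i j)\<bar> \<le> 1 * (L * h)"
    unfolding abs_mult using row_sum[OF i] by (intro mult_mono) auto
  moreover have "(\<Sum>j<n. W i j * z j) = s / N * (\<Sum>j<n. W i j) + (\<Sum>j<n. W i j * (z j - s / N))"
    by (simp add: right_diff_distrib sum_subtractf sum_distrib_left mult_ac)
  ultimately have "\<bar>\<Sum>j<n. W i j * z j\<bar> \<le> 1 * (L * h) + L * h"
    by (simp only:) (rule order_trans[OF abs_triangle_ineq add_mono[OF _ 1]])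
  then show ?thesis using snr by simp
qed

lemma dev: "(xx - \<alpha>\<^sup>2 / N) + (yy - \<beta>\<^sup>2 / N) = N - D / N"
  unfolding D_def xx_yy[symmetric] by (simp add: add_divide_distrib)

text \<open>The squared deviations of the two columns from their means are nonnegative and sum to
  \<open>N - D / N\<close> by \<open>dev\<close>, so each column alone meets the hypotheses of
  \<open>row_product_le\<close>.\<close>

lemma Wx_le: "i < n \<Longrightarrow> \<bar>Wx i\<bar> \<le> a * N / 500" and Wy_le: "i < n \<Longrightarrow> \<bar>Wy i\<bar> \<le> a * N / 500"
proof -
  have "0 \<le> xx - \<alpha>\<^sup>2 / N" "0 \<le> yy - \<beta>\<^sup>2 / N" using sum_sq_le n_pos by (auto simp: divide_le_eq)
  then have "xx - \<alpha>\<^sup>2 / N \<le> N - D / N" "yy - \<beta>\<^sup>2 / N \<le> N - D / N" using dev by linarith+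
  moreover have "\<alpha>\<^sup>2 \<le> N\<^sup>2" "\<beta>\<^sup>2 \<le> N\<^sup>2"
    using D_le zero_le_power2[of \<alpha>] zero_le_power2[of \<beta>] unfolding D_def by linarith+
  ultimately show "i < n \<Longrightarrow> \<bar>Wx i\<bar> \<le> a * N / 500" and "i < n \<Longrightarrow> \<bar>Wy i\<bar> \<le> a * N / 500"
    unfolding Wx_def Wy_def xx_def yy_def \<alpha>_def \<beta>_def by (blast intro: row_product_le)+
qed

text \<open>By the first-order equations, \<open>(S i)\<^sup>2\<close> is the squared length of
  \<open>a\<close> times the summed row plus a small noise vector, which bounds the absolute value
  of \<open>S i\<close> below. The second-order condition at a coordinate vector settles the
  sign.\<close>

lemma S_ge: assumes i: "i < n" shows "a * N / 2 \<le> S i"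
proof -
  let ?z = "a * N"
  have half: "p\<^sup>2 / 2 - w\<^sup>2 \<le> (p + w)\<^sup>2" for p w :: real
  proof -
    have "(p + w)\<^sup>2 - (p\<^sup>2 / 2 - w\<^sup>2) = (p + 2 * w)\<^sup>2 / 2" by (simp add: power2_eq_square algebra_simps)
    moreover have "0 \<le> \<dots>" by simp
    ultimately show ?thesis by linarith
  qed
  have sq: "(Wx i)\<^sup>2 \<le> (?z / 500)\<^sup>2" "(Wy i)\<^sup>2 \<le> (?z / 500)\<^sup>2"
    using Wx_le[OF i] Wy_le[OF i] large by (auto simp: abs_le_square_iff[symmetric])
  have "(S i)\<^sup>2 = (S i * x i)\<^sup>2 + (S i * y i)\<^sup>2"
    using unit[OF i] by (simp add: power_mult_distrib flip: distrib_left)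
  also have "\<dots> \<ge> ((a * \<alpha>)\<^sup>2 / 2 - (Wx i)\<^sup>2) + ((a * \<beta>)\<^sup>2 / 2 - (Wy i)\<^sup>2)"
    unfolding first_order_x[OF i] first_order_y[OF i] by (intro add_mono half)
  finally have "(a * \<alpha>)\<^sup>2 / 2 + (a * \<beta>)\<^sup>2 / 2 - 2 * (?z / 500)\<^sup>2 \<le> (S i)\<^sup>2" using sq by linarith
  moreover have "(a * \<alpha>)\<^sup>2 / 2 + (a * \<beta>)\<^sup>2 / 2 = a\<^sup>2 * D / 2" unfolding D_def by (simp add: power_mult_distrib algebra_simps)
  moreover have "a\<^sup>2 * (N\<^sup>2 * (846 / 1000)) \<le> a\<^sup>2 * D" using D_ge' by (intro mult_left_mono) auto
  moreover have "a\<^sup>2 * (N\<^sup>2 * (846 / 1000)) = ?z\<^sup>2 * (846 / 1000)" by (simp add: power_mult_distrib)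
  ultimately have "?z\<^sup>2 * (423 / 1000) - 2 * (?z / 500)\<^sup>2 \<le> (S i)\<^sup>2" by linarith
  \<comment> \<open>0.36 is a convenient square below 0.423, with room for the noise.\<close>
  moreover have "?z\<^sup>2 * (36 / 100) \<le> ?z\<^sup>2 * (423 / 1000) - 2 * (?z / 500)\<^sup>2"
    using zero_le_power2[of ?z] unfolding power_divide by (simp only: power2_eq_square[of 500])
  moreover have "?z\<^sup>2 * (36 / 100) = (6 / 10 * ?z)\<^sup>2" by (simp add: power2_eq_square)
  ultimately have "(6 / 10 * ?z)\<^sup>2 \<le> (S i)\<^sup>2" by linarith
  then have "\<bar>6 / 10 * ?z\<bar> \<le> \<bar>S i\<bar>" by (simp only: abs_le_square_iff)
  \<comment> \<open>A negative \<open>S i\<close> would be at most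
    \<open>- 6 / 10 * ?z \<le> -1.2\<close>.\<close>
  moreover have "-1 \<le> S i"
  proof -
    let ?v = "\<lambda>j. if j = i then 1 else 0 :: real"
    have "(\<Sum>j<n. \<Sum>k<n. (a + W j k) * (x j * x k + y j * y k) * ?v j * ?v k)
        = (\<Sum>j<n. \<Sum>k<n. if i = k then if i = j then a + W i i else 0 else 0)"
      using unit[OF i] by (intro sum.cong refl) (auto simp: power2_eq_square)
    also have "\<dots> = a + W i i" using i by (simp only: sum.delta' finite_lessThan lessThan_iff if_True)
    finally have "(\<Sum>j<n. \<Sum>k<n. (a + W j k) * (x j * x k + y j * y k) * ?v j * ?v k) = a + W i i" .
    moreover have "(\<Sum>j<n. S j * (?v j)\<^sup>2) = (\<Sum>j<n. if i = j then S j else 0)"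
      by (intro sum.cong refl) auto
    then have "(\<Sum>j<n. S j * (?v j)\<^sup>2) = S i" using i by simp
    ultimately show ?thesis using second_order[of ?v] diag[OF i] by simp
  qed
  ultimately show ?thesis using large by linarith
qed

text \<open>In the cross product of the first-order equations with
  \<open>(\<alpha>, \<beta>)\<close> the signal cancels, leaving \<open>S u = W u\<close>. The
  diagonal \<open>S\<close> stretches \<open>u\<close> by at least \<open>a * N / 2\<close>, while
  \<open>W\<close> stretches it by at most \<open>2 * L * h\<close>, which is at most
  \<open>a * N / 500\<close>.\<close>

lemma u_eq_0: assumes "i < n" shows "u i = 0"
proof -
  let ?U = "\<Sum>i<n. (u i)\<^sup>2"
  have Su: "S i * u i = (\<Sum>j<n. W j i * u j)" if "i < n" for i
  proof -
    have "S i * u i = \<alpha> * (S i * y i) - \<beta> * (S i * x i)" unfolding u_def by (simp add: algebra_simps)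
    also have "\<dots> = \<alpha> * Wy i - \<beta> * Wx i"
      unfolding first_order_x[OF that] first_order_y[OF that] by (simp add: algebra_simps)
    also have "\<dots> = (\<Sum>j<n. W j i * u j)"
      unfolding Wx_def Wy_def u_def sum_distrib_left sum_subtractf[symmetric] sym[of i]
      by (intro sum.cong refl) (simp add: algebra_simps)
    finally show ?thesis .
  qed
  have "(a * N / 2)\<^sup>2 * ?U \<le> (\<Sum>i<n. (S i * u i)\<^sup>2)"
    unfolding sum_distrib_left power_mult_distrib
    using S_ge large by (intro sum_mono mult_right_mono power_mono) auto
  also have "\<dots> = (\<Sum>i<n. (\<Sum>j<n. W j i * u j)\<^sup>2)" using Su by simp
  also have "\<dots> \<le> (3 * h\<^sup>2 + L\<^sup>2 * h\<^sup>2) * ?U"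
    by (intro norm_mult_vec_le_of_gram row_norm gram) auto
  also have "\<dots> \<le> (4 * (L * h)\<^sup>2) * ?U"
  proof (intro mult_right_mono)
    have "1 * h\<^sup>2 \<le> L\<^sup>2 * h\<^sup>2" using L(2) by (intro mult_right_mono) auto
    then show "3 * h\<^sup>2 + L\<^sup>2 * h\<^sup>2 \<le> 4 * (L * h)\<^sup>2" by (simp add: power_mult_distrib)
  qed (simp add: sum_nonneg)
  also have "\<dots> \<le> (4 * (a * N / 1000)\<^sup>2) * ?U"
    using snr L h by (intro mult_right_mono mult_left_mono power_mono) (auto simp: sum_nonneg)
  finally have "(a * N)\<^sup>2 * (1 / 4 - 4 / 1000000) * ?U \<le> 0" unfolding power_divide by (simp add: field_simps)
  moreover have "0 < (a * N)\<^sup>2" using large by (intro zero_less_power) linarith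
  ultimately have "?U \<le> 0" by (simp add: mult_le_0_iff)
  then have "?U = 0" by (simp add: antisym sum_nonneg)
  then show ?thesis using assms by (simp add: sum_nonneg_eq_0_iff)
qed

text \<open>With \<open>u = 0\<close> every row is plus or minus the normalised mean row. The sign
  is always plus: \<open>S k\<close> equals \<open>a * t k\<close> up to noise, and
  \<open>S k\<close> is large and positive.\<close>

theorem inner_eq_1: assumes i: "i < n" and j: "j < n" shows "x i * x j + y i * y j = 1"
proof -
  define t where "t k = \<alpha> * x k + \<beta> * y k" for k
  have pos: "0 < t k" if k: "k < n" for k
  proof -
    have "S k = S k * ((x k)\<^sup>2 + (y k)\<^sup>2)" using unit[OF k] by simp
    also have "\<dots> = (S k * x k) * x k + (S k * y k) * y k" by (simp add: power2_eq_square algebra_simps)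
    also have "\<dots> = a * t k + (Wx k * x k + Wy k * y k)"
      unfolding first_order_x[OF k] first_order_y[OF k] t_def by (simp add: algebra_simps)
    finally have "S k = a * t k + (Wx k * x k + Wy k * y k)" .
    moreover have "\<bar>Wx k * x k\<bar> \<le> a * N / 500 * 1" "\<bar>Wy k * y k\<bar> \<le> a * N / 500 * 1"
      unfolding abs_mult using Wx_le Wy_le x_le y_le k large by (intro mult_mono; simp)+
    ultimately have "0 < a * t k" using S_ge[OF k] large by linarith
    then show ?thesis using a_pos by (simp add: zero_less_mult_iff)
  qed
  have sq: "(t k)\<^sup>2 = D" if "k < n" for k
  proof -
    have "(u k)\<^sup>2 + (t k)\<^sup>2 = D * ((x k)\<^sup>2 + (y k)\<^sup>2)"
      unfolding u_def t_def D_def by (simp add: power2_eq_square algebra_simps)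
    then show ?thesis using u_eq_0[OF that] unit[OF that] by simp
  qed
  have "t i = t j" using sq[OF i] sq[OF j] pos[OF i] pos[OF j] by (metis less_imp_le power2_eq_iff_nonneg)
  have "D * (x i * x j + y i * y j) = t i * t j + u i * u j"
    unfolding D_def t_def u_def by (simp add: power2_eq_square algebra_simps)
  also have "\<dots> = D" using u_eq_0[OF i] sq[OF i] \<open>t i = t j\<close> by (simp add: power2_eq_square)
  finally show ?thesis using D_pos by simp
qed

end

section \<open>Concentration of the noise\<close>

lemma exp_le_one_plus_plus_square:
  fixes x :: real
  assumes "\<bar>x\<bar> \<le> 1"
  shows "exp x \<le> 1 + x + x\<^sup>2"
proof (cases "0 \<le> x")
  case True
  then show ?thesis using exp_bound assms by simp
next
  case False
  \<comment> \<open>For negative \<open>x\<close> the product equals \<open>1 - x ^ 3\<close>; it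
    remains to replace \<open>1 - x\<close> by the larger \<open>exp (- x)\<close>.\<close>
  have "1 \<le> (1 - x) * (1 + x + x\<^sup>2)"
  proof -
    have "(1 - x) * (1 + x + x\<^sup>2) = 1 + (- x) ^ 3" by (simp add: power2_eq_square power3_eq_cube algebra_simps)
    moreover have "0 \<le> (- x) ^ 3" using False by (intro zero_le_power) simp
    ultimately show ?thesis by linarith
  qed
  also have "\<dots> \<le> exp (- x) * (1 + x + x\<^sup>2)"
    using exp_ge_add_one_self[of "- x"] assms by (intro mult_right_mono) auto
  finally show ?thesis by (simp add: exp_minus field_simps)
qed

text \<open>Centring removes the linear term and leaves the variance. Keeping the factor
  \<open>p\<close> in the exponent makes the tails scale with the edge density.\<close>

lemma bernoulli_centered_mgf_le:
  assumes "0 \<le> p" "p \<le> 1" "\<bar>c\<bar> \<le> 1"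
  shows "measure_pmf.expectation (bernoulli_pmf p) (\<lambda>b. exp (c * (of_bool b - p))) \<le> exp (c\<^sup>2 * p)"
proof -
  have le: "\<bar>c * (1 - p)\<bar> \<le> 1" "\<bar>c * (0 - p)\<bar> \<le> 1"
    using assms by (auto simp: abs_mult intro!: mult_le_one)
  have "measure_pmf.expectation (bernoulli_pmf p) (\<lambda>b. exp (c * (of_bool b - p)))
      = exp (c * (1 - p)) * p + exp (c * (0 - p)) * (1 - p)"
    using assms by simp
  also have "\<dots> \<le> (1 + c * (1 - p) + (c * (1 - p))\<^sup>2) * p
      + (1 + c * (0 - p) + (c * (0 - p))\<^sup>2) * (1 - p)"
    using assms by (intro add_mono mult_right_mono exp_le_one_plus_plus_square le) auto
  also have "\<dots> = 1 + c\<^sup>2 * p - (c * p)\<^sup>2"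
    by (simp add: power2_eq_square algebra_simps)
  also have "\<dots> \<le> 1 + c\<^sup>2 * p" by simp
  also have "\<dots> \<le> exp (c\<^sup>2 * p)" by (rule exp_ge_add_one_self)
  finally show ?thesis .
qed

lemma integrable_Pi_pmf_finite:
  fixes f :: "_ \<Rightarrow> real" and p :: "_ \<Rightarrow> bool pmf"
  assumes "finite A"
  shows "integrable (measure_pmf (Pi_pmf A d p)) f"
  using assms by (intro integrable_measure_pmf_finite)
    (simp add: set_Pi_pmf finite_PiE_dflt)

text \<open>Exponential Markov inequality with parameter 1; the choice of scale is left to the
  coefficients \<open>c\<close>.\<close>

lemma Pi_bernoulli_chernoff:
  assumes A: "finite A" and p: "\<And>e. e \<in> A \<Longrightarrow> 0 \<le> p e \<and> p e \<le> 1"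
    and c: "\<And>e. e \<in> A \<Longrightarrow> \<bar>c e\<bar> \<le> 1"
  shows "measure_pmf.prob (Pi_pmf A d (\<lambda>e. bernoulli_pmf (p e)))
      {X. T \<le> (\<Sum>e\<in>A. c e * (of_bool (X e) - p e))} \<le> exp ((\<Sum>e\<in>A. (c e)\<^sup>2 * p e) - T)"
proof -
  let ?M = "Pi_pmf A d (\<lambda>e. bernoulli_pmf (p e))"
  let ?f = "\<lambda>X. \<Prod>e\<in>A. exp (c e * (of_bool (X e) - p e))"
  have "measure_pmf.prob ?M {X. T \<le> (\<Sum>e\<in>A. c e * (of_bool (X e) - p e))}
      = measure_pmf.prob ?M {X\<in>space ?M. ?f X \<ge> exp T}"
    using A by (simp flip: exp_sum)
  also have "\<dots> \<le> measure_pmf.expectation ?M ?f / exp T"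
    using A by (intro integral_Markov_inequality_measure[where A = UNIV] integrable_Pi_pmf_finite)
      (auto simp: prod_nonneg)
  also have "measure_pmf.expectation ?M ?f
      = (\<Prod>e\<in>A. measure_pmf.expectation (bernoulli_pmf (p e)) (\<lambda>b. exp (c e * (of_bool b - p e))))"
    using A by (intro expectation_prod_Pi_pmf) (auto intro: integrable_measure_pmf_finite)
  also have "\<dots> \<le> (\<Prod>e\<in>A. exp ((c e)\<^sup>2 * p e))"
    using p c by (intro prod_mono conjI bernoulli_centered_mgf_le) auto
  also have "\<dots> = exp (\<Sum>e\<in>A. (c e)\<^sup>2 * p e)" using A by (simp add: exp_sum)
  finally show ?thesis by (simp add: exp_diff divide_right_mono)
qed

text \<open>The hypothesis on \<open>G\<close> says that it ignores coordinate \<open>e\<close>, so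
  it is independent of \<open>X e\<close>. The proof draws that coordinate separately from the
  rest.\<close>

lemma Pi_pmf_expectation_coordinate_mult:
  fixes p :: "'a \<Rightarrow> bool pmf" and f :: "bool \<Rightarrow> real"
  assumes A: "finite A" "e \<in> A" and G: "\<And>X b. G (X(e := b)) = G X"
  shows "measure_pmf.expectation (Pi_pmf A d p) (\<lambda>X. f (X e) * G X)
    = measure_pmf.expectation (p e) f * measure_pmf.expectation (Pi_pmf A d p) G"
proof -
  define B where "B = A - {e}"
  have AB: "A = insert e B" "finite B" "e \<notin> B" using A unfolding B_def by auto
  have fin: "finite (set_pmf (Pi_pmf B d p))"
    using AB by (simp add: set_Pi_pmf finite_PiE_dflt)
  have split: "measure_pmf.expectation (Pi_pmf A d p) H
      = (\<Sum>b\<in>UNIV. pmf (p e) b * measure_pmf.expectation (Pi_pmf B d p) (\<lambda>X. H (X(e := b))))"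
    for H :: "('a \<Rightarrow> bool) \<Rightarrow> real"
  proof -
    have "Pi_pmf A d p = p e \<bind> (\<lambda>b. map_pmf (\<lambda>X. X(e := b)) (Pi_pmf B d p))"
      unfolding AB(1) using AB by (simp add: Pi_pmf_insert' map_pmf_def)
    then show ?thesis by (simp add: pmf_expectation_bind[where A = UNIV] fin)
  qed
  have "(\<Sum>b\<in>UNIV. pmf (p e) b) = 1" by (rule sum_pmf_eq_1) auto
  then have EG: "measure_pmf.expectation (Pi_pmf A d p) G = measure_pmf.expectation (Pi_pmf B d p) G"
    unfolding split G by (simp flip: sum_distrib_right)
  have "measure_pmf.expectation (p e) f = (\<Sum>b\<in>UNIV. pmf (p e) b * f b)"
    by (subst integral_measure_pmf[where A = UNIV]) auto
  then show ?thesis unfolding EG unfolding split G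
    by (simp add: sum_distrib_left mult_ac)
qed

section \<open>Edge indicators and the noise matrix\<close>

definition edges :: "nat \<Rightarrow> (nat \<times> nat) set" where
  "edges n = {(i, j). i \<le> j \<and> j < n}"

definition edge :: "nat \<Rightarrow> nat \<Rightarrow> nat \<times> nat" where
  "edge i j = (min i j, max i j)"

text \<open>An adjacency entry minus its mean; reading both triangles through \<open>edge\<close>
  makes the matrix symmetric.\<close>

definition noise :: "(nat \<times> nat \<Rightarrow> real) \<Rightarrow> (nat \<times> nat \<Rightarrow> bool) \<Rightarrow> nat \<Rightarrow> nat \<Rightarrow> real" where
  "noise p X i j = of_bool (X (edge i j)) - p (edge i j)"

abbreviation random_graph :: "nat \<Rightarrow> (nat \<times> nat \<Rightarrow> real) \<Rightarrow> (nat \<times> nat \<Rightarrow> bool) pmf" where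
  "random_graph n p \<equiv> Pi_pmf (edges n) False (\<lambda>e. bernoulli_pmf (p e))"

lemma finite_edges [simp]: "finite (edges n)"
  by (rule finite_subset[of _ "{..<n} \<times> {..<n}"]) (auto simp: edges_def)

lemma edge_in_edges: "i < n \<Longrightarrow> j < n \<Longrightarrow> edge i j \<in> edges n"
  by (auto simp: edge_def edges_def)

lemma edge_eq_iff: "edge i j = edge k l \<longleftrightarrow> i = k \<and> j = l \<or> i = l \<and> j = k"
  by (auto simp: edge_def min_def max_def)

text \<open>Folds a double sum onto the independent indicators: the strict lower triangle is the
  mirror image of the strict upper one.\<close>

lemma sum_square_eq_sum_edges:
  fixes F :: "nat \<Rightarrow> nat \<Rightarrow> real"
  shows "(\<Sum>i<n. \<Sum>j<n. F i j) = (\<Sum>(i, j)\<in>edges n. if i = j then F i j else F i j + F j i)"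
proof -
  let ?L = "{(i, j). i < j \<and> j < n}"
  have fin: "finite ?L" by (rule finite_subset[OF _ finite_edges[of n]]) (auto simp: edges_def)
  have inj: "inj_on prod.swap ?L" by (auto simp: inj_on_def)
  have un: "{..<n} \<times> {..<n} = edges n \<union> prod.swap ` ?L" by (force simp: edges_def image_iff)
  have disj: "edges n \<inter> prod.swap ` ?L = {}" by (auto simp: edges_def)
  have "(\<Sum>i<n. \<Sum>j<n. F i j) = (\<Sum>(i, j)\<in>{..<n} \<times> {..<n}. F i j)"
    by (rule sum.cartesian_product)
  also have "\<dots> = (\<Sum>(i, j)\<in>edges n. F i j) + (\<Sum>(i, j)\<in>prod.swap ` ?L. F i j)"
    unfolding un using disj fin by (intro sum.union_disjoint) auto
  also have "(\<Sum>(i, j)\<in>prod.swap ` ?L. F i j) = (\<Sum>(i, j)\<in>?L. F j i)"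
    by (subst sum.reindex[OF inj]) (simp add: case_prod_unfold)
  also have "\<dots> = (\<Sum>(i, j)\<in>edges n. if i = j then 0 else F j i)"
    by (rule sum.mono_neutral_cong_left[OF finite_edges]) (auto simp: edges_def split: if_splits)
  also have "(\<Sum>(i, j)\<in>edges n. F i j) + \<dots> = (\<Sum>(i, j)\<in>edges n. if i = j then F i j else F i j + F j i)"
    unfolding sum.distrib[symmetric] by (rule sum.cong) auto
  finally show ?thesis .
qed

section \<open>Tail and moment bounds for the noise matrix\<close>

context
  fixes n :: nat and p :: "nat \<times> nat \<Rightarrow> real" and \<rho> :: real
  assumes p: "\<And>e. 0 \<le> p e \<and> p e \<le> 1 \<and> p e \<le> \<rho>"
begin

text \<open>After folding, an off-diagonal edge carries \<open>B i j + B j i\<close>: the bound 1/2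
  keeps this within 1, and the square of the sum costs the factor 2 in the exponent.\<close>

lemma noise_bilinear_tail:
  assumes B: "\<And>i j. i < n \<Longrightarrow> j < n \<Longrightarrow> \<bar>B i j\<bar> \<le> 1 / 2"
  shows "measure_pmf.prob (random_graph n p) {X. T \<le> (\<Sum>i<n. \<Sum>j<n. B i j * noise p X i j)}
    \<le> exp (2 * \<rho> * (\<Sum>i<n. \<Sum>j<n. (B i j)\<^sup>2) - T)"
proof -
  define c where "c = (\<lambda>(i, j). if i = j then B i j else B i j + B j i)"
  have eq: "(\<Sum>i<n. \<Sum>j<n. B i j * noise p X i j) = (\<Sum>e\<in>edges n. c e * (of_bool (X e) - p e))" for X
    unfolding sum_square_eq_sum_edges
    by (rule sum.cong) (auto simp: c_def noise_def edge_def edges_def algebra_simps)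
  have c_le: "\<bar>c e\<bar> \<le> 1" if e_in: "e \<in> edges n" for e
  proof -
    obtain i j where e: "e = (i, j)" "i < n" "j < n" using e_in by (auto simp: edges_def)
    show ?thesis using B[OF e(2,3)] B[OF e(3,2)] unfolding e(1) c_def by auto
  qed
  have "(\<Sum>e\<in>edges n. (c e)\<^sup>2 * p e)
      \<le> (\<Sum>e\<in>edges n. 2 * \<rho> * (\<lambda>(i, j). if i = j then (B i j)\<^sup>2 else (B i j)\<^sup>2 + (B j i)\<^sup>2) e)"
  proof (rule sum_mono)
    fix e :: "nat \<times> nat"
    obtain i j where e: "e = (i, j)" by (cases e)
    have "(B i j + B j i)\<^sup>2 \<le> 2 * ((B i j)\<^sup>2 + (B j i)\<^sup>2)"
      using zero_le_power2[of "B i j - B j i"] by (simp add: power2_eq_square algebra_simps)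
    then have "(c e)\<^sup>2 \<le> 2 * (\<lambda>(i, j). if i = j then (B i j)\<^sup>2 else (B i j)\<^sup>2 + (B j i)\<^sup>2) e"
      by (auto simp: e c_def)
    then have "(c e)\<^sup>2 * p e \<le> 2 * (\<lambda>(i, j). if i = j then (B i j)\<^sup>2 else (B i j)\<^sup>2 + (B j i)\<^sup>2) e * \<rho>"
      using p[of e] by (intro mult_mono) (auto split: prod.split)
    then show "(c e)\<^sup>2 * p e \<le> 2 * \<rho> * (\<lambda>(i, j). if i = j then (B i j)\<^sup>2 else (B i j)\<^sup>2 + (B j i)\<^sup>2) e"
      by (simp only: mult_ac)
  qed
  also have "\<dots> = 2 * \<rho> * (\<Sum>i<n. \<Sum>j<n. (B i j)\<^sup>2)"
    unfolding sum_square_eq_sum_edges sum_distrib_left ..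
  finally have "exp ((\<Sum>e\<in>edges n. (c e)\<^sup>2 * p e) - T) \<le> exp (2 * \<rho> * (\<Sum>i<n. \<Sum>j<n. (B i j)\<^sup>2) - T)"
    by simp
  moreover have "measure_pmf.prob (random_graph n p) {X. T \<le> (\<Sum>i<n. \<Sum>j<n. B i j * noise p X i j)}
      \<le> exp ((\<Sum>e\<in>edges n. (c e)\<^sup>2 * p e) - T)"
    unfolding eq using p c_le by (intro Pi_bernoulli_chernoff[OF finite_edges]) auto
  ultimately show ?thesis by linarith
qed

lemma expectation_noise_mult:
  assumes "i < n" "j < n" "\<And>X b. G (X(edge i j := b)) = G X"
  shows "measure_pmf.expectation (random_graph n p) (\<lambda>X. noise p X i j * G X) = 0"
  unfolding noise_def
  using p[of "edge i j"] assms
  by (subst Pi_pmf_expectation_coordinate_mult[where f = "\<lambda>b. of_bool b - p (edge i j)"])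
    (auto simp: edge_in_edges algebra_simps)

lemma expectation_noise_sq_mult:
  assumes "i < n" "j < n" "\<And>X b. G (X(edge i j := b)) = G X" "\<And>X. 0 \<le> G X"
  shows "measure_pmf.expectation (random_graph n p) (\<lambda>X. (noise p X i j)\<^sup>2 * G X)
    \<le> \<rho> * measure_pmf.expectation (random_graph n p) G"
proof -
  let ?q = "p (edge i j)"
  have "measure_pmf.expectation (bernoulli_pmf ?q) (\<lambda>b. (of_bool b - ?q)\<^sup>2) = ?q - ?q\<^sup>2"
    using p[of "edge i j"] by (simp add: power2_eq_square algebra_simps)
  also have "\<dots> \<le> ?q" by simp
  also have "\<dots> \<le> \<rho>" using p by simp
  finally have "measure_pmf.expectation (bernoulli_pmf ?q) (\<lambda>b. (of_bool b - ?q)\<^sup>2) \<le> \<rho>" .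
  then show ?thesis unfolding noise_def using assms
    by (subst Pi_pmf_expectation_coordinate_mult[where f = "\<lambda>b. (of_bool b - ?q)\<^sup>2"])
      (auto simp: edge_in_edges intro!: mult_right_mono Bochner_Integration.integral_nonneg)
qed

text \<open>For \<open>j = l\<close> two distinct edges occur squared. Otherwise some edge occurs
  exactly once, and its centred factor annihilates the expectation.\<close>

lemma expectation_noise_four_cycle:
  assumes "i < n" "k < n" "j < n" "l < n" "i \<noteq> k"
  shows "measure_pmf.expectation (random_graph n p)
      (\<lambda>X. (noise p X i j * noise p X k j) * (noise p X i l * noise p X k l)) \<le> (if j = l then \<rho>\<^sup>2 else 0)"
proof -
  let ?E = "measure_pmf.expectation (random_graph n p)"
  have upd: "noise p (X(edge a b := v)) c d = noise p X c d" if "edge c d \<noteq> edge a b" for X a b v c d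
    using that by (simp add: noise_def)
  \<comment> \<open>For \<open>j \<noteq> l\<close> the edge \<open>edge i j\<close> occurs once
    unless it coincides with \<open>edge k l\<close>, that is, \<open>i = l\<close> and
    \<open>j = k\<close>; then the loop at \<open>k\<close> occurs once instead.\<close>
  consider "j = l" | "j \<noteq> l" "i = l" "j = k" | "j \<noteq> l" "\<not> (i = l \<and> j = k)" by blast
  then show ?thesis
  proof cases
    case 1
    have "?E (\<lambda>X. (noise p X i j * noise p X k j) * (noise p X i l * noise p X k l))
        = ?E (\<lambda>X. (noise p X i j)\<^sup>2 * ((noise p X k j)\<^sup>2 * 1))"
      unfolding 1 by (simp add: power2_eq_square mult_ac)
    also have "\<dots> \<le> \<rho> * ?E (\<lambda>X. (noise p X k j)\<^sup>2 * 1)"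
      using assms by (intro expectation_noise_sq_mult) (auto simp: upd edge_eq_iff)
    also have "\<dots> \<le> \<rho> * (\<rho> * ?E (\<lambda>X. 1))"
      using assms p[of undefined] by (intro mult_left_mono expectation_noise_sq_mult) auto
    finally show ?thesis using 1 by (simp add: power2_eq_square)
  next
    case 2
    have "?E (\<lambda>X. (noise p X i j * noise p X k j) * (noise p X i l * noise p X k l))
        = ?E (\<lambda>X. noise p X k j * (noise p X i j * (noise p X i l * noise p X k l)))"
      by (simp add: mult_ac)
    also have "\<dots> = 0"
      using assms 2 by (intro expectation_noise_mult) (auto simp: upd edge_eq_iff)
    finally show ?thesis using 2 by simp
  next
    case 3
    have "?E (\<lambda>X. (noise p X i j * noise p X k j) * (noise p X i l * noise p X k l))
        = ?E (\<lambda>X. noise p X i j * (noise p X k j * (noise p X i l * noise p X k l)))"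
      by (simp add: mult_ac)
    also have "\<dots> = 0"
      using assms 3 by (intro expectation_noise_mult) (auto simp: upd edge_eq_iff)
    finally show ?thesis using 3 by simp
  qed
qed

text \<open>In each squared Gram entry only the \<open>n\<close> terms with \<open>j = l\<close>
  contribute, each at most \<open>\<rho>\<^sup>2\<close>.\<close>

lemma expectation_noise_gram_le:
  "measure_pmf.expectation (random_graph n p)
      (\<lambda>X. \<Sum>i<n. \<Sum>k\<in>{..<n}-{i}. (\<Sum>j<n. noise p X i j * noise p X k j)\<^sup>2) \<le> real n ^ 3 * \<rho>\<^sup>2"
proof -
  let ?E = "measure_pmf.expectation (random_graph n p)"
  have int: "integrable (random_graph n p) f" for f :: "_ \<Rightarrow> real"
    by (rule integrable_Pi_pmf_finite) simp
  have inner: "?E (\<lambda>X. (\<Sum>j<n. noise p X i j * noise p X k j)\<^sup>2) \<le> real n * \<rho>\<^sup>2"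
    if "i < n" "k < n" "i \<noteq> k" for i k
  proof -
    have "?E (\<lambda>X. (\<Sum>j<n. noise p X i j * noise p X k j)\<^sup>2)
        = (\<Sum>j<n. \<Sum>l<n. ?E (\<lambda>X. (noise p X i j * noise p X k j) * (noise p X i l * noise p X k l)))"
      by (simp add: power2_eq_square sum_product Bochner_Integration.integral_sum int)
    also have "\<dots> \<le> (\<Sum>j<n. \<Sum>l<n. if j = l then \<rho>\<^sup>2 else 0)"
      using that by (intro sum_mono expectation_noise_four_cycle) auto
    also have "\<dots> = real n * \<rho>\<^sup>2" by simp
    finally show ?thesis .
  qed
  have "?E (\<lambda>X. \<Sum>i<n. \<Sum>k\<in>{..<n}-{i}. (\<Sum>j<n. noise p X i j * noise p X k j)\<^sup>2)
      = (\<Sum>i<n. \<Sum>k\<in>{..<n}-{i}. ?E (\<lambda>X. (\<Sum>j<n. noise p X i j * noise p X k j)\<^sup>2))"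
    by (simp add: Bochner_Integration.integral_sum int)
  also have "\<dots> \<le> (\<Sum>i<n. \<Sum>k\<in>{..<n}-{i}. real n * \<rho>\<^sup>2)"
    by (intro sum_mono inner) auto
  also have "\<dots> \<le> (\<Sum>i<n. \<Sum>k<n. real n * \<rho>\<^sup>2)"
    by (intro sum_mono sum_mono2) auto
  also have "\<dots> = real n ^ 3 * \<rho>\<^sup>2" by (simp add: power3_eq_cube)
  finally show ?thesis .
qed

lemma noise_gram_tail:
  assumes "0 < \<tau>"
  shows "measure_pmf.prob (random_graph n p)
      {X. \<tau> \<le> (\<Sum>i<n. \<Sum>k\<in>{..<n}-{i}. (\<Sum>j<n. noise p X i j * noise p X k j)\<^sup>2)}
    \<le> real n ^ 3 * \<rho>\<^sup>2 / \<tau>"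
proof -
  let ?f = "\<lambda>X. \<Sum>i<n. \<Sum>k\<in>{..<n}-{i}. (\<Sum>j<n. noise p X i j * noise p X k j)\<^sup>2"
  have "measure_pmf.prob (random_graph n p) {X\<in>space (random_graph n p). \<tau> \<le> ?f X}
      \<le> measure_pmf.expectation (random_graph n p) ?f / \<tau>"
    using assms by (intro integral_Markov_inequality_measure[where A = UNIV] integrable_Pi_pmf_finite)
      (auto intro!: sum_nonneg)
  also have "\<dots> \<le> real n ^ 3 * \<rho>\<^sup>2 / \<tau>"
    using assms expectation_noise_gram_le by (intro divide_right_mono) auto
  finally show ?thesis by simp
qed

lemma noise_row_tail:
  assumes i: "i < n" and y: "\<And>j. j < n \<Longrightarrow> \<bar>y j\<bar> \<le> 1" and h: "2 \<le> h" "h\<^sup>2 = real n * \<rho>"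
  shows "measure_pmf.prob (random_graph n p) {X. L * h \<le> (\<Sum>j<n. noise p X i j * y j)} \<le> exp (2 - L)"
proof -
  \<comment> \<open>Only row \<open>i\<close> is active. Dividing by \<open>h \<ge> 2\<close> gives
    entries of size at most 1/2 and, since \<open>h\<^sup>2 = n * \<rho>\<close>, a variance term of
    at most 2.\<close>
  define B where "B k j = (if k = i then y j / h else 0)" for k j
  have le: "\<bar>B k j\<bar> \<le> 1 / 2" if "k < n" "j < n" for k j
    using y[OF that(2)] h(1) unfolding B_def by (auto simp: divide_le_eq)
  have row: "(\<Sum>k<n. \<Sum>j<n. f k j) = (\<Sum>j<n. f i j)" if "\<And>k j. k \<noteq> i \<Longrightarrow> f k j = 0"
    for f :: "nat \<Rightarrow> nat \<Rightarrow> real"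
    by (subst sum.remove[of _ i]) (use i that in auto)
  have "(\<Sum>k<n. \<Sum>j<n. B k j * noise p X k j) = (\<Sum>j<n. noise p X i j * y j) / h" for X
    by (subst row) (auto simp: B_def sum_divide_distrib mult_ac)
  then have set_eq: "{X. L * h \<le> (\<Sum>j<n. noise p X i j * y j)} = {X. L \<le> (\<Sum>k<n. \<Sum>j<n. B k j * noise p X k j)}"
    using h(1) by (simp add: le_divide_eq)
  have "(\<Sum>k<n. \<Sum>j<n. (B k j)\<^sup>2) = (\<Sum>j<n. (y j)\<^sup>2) / h\<^sup>2"
    by (subst row) (auto simp: B_def sum_divide_distrib power_divide)
  also have "\<dots> \<le> real n / h\<^sup>2"
    using y by (intro divide_right_mono sum_bounded_above[of "{..<n}" _ 1, simplified]) (auto simp: abs_square_le_1)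
  finally have "2 * \<rho> * (\<Sum>k<n. \<Sum>j<n. (B k j)\<^sup>2) \<le> 2 * \<rho> * (real n / h\<^sup>2)"
    using p[of undefined] by (intro mult_left_mono) auto
  also have "\<dots> = 2 * (real n * \<rho> / h\<^sup>2)" by simp
  also have "\<dots> = 2" using h(1) unfolding h(2)[symmetric] by simp
  finally have "exp (2 * \<rho> * (\<Sum>k<n. \<Sum>j<n. (B k j)\<^sup>2) - L) \<le> exp (2 - L)" by simp
  with noise_bilinear_tail[of B L, OF le] show ?thesis unfolding set_eq by (rule order_trans)
qed

lemma noise_cut_tail_single:
  assumes s: "\<And>i. i < n \<Longrightarrow> \<bar>s i\<bar> \<le> 1" "\<And>i. i < n \<Longrightarrow> \<bar>t i\<bar> \<le> 1" and h: "2 \<le> h" "h\<^sup>2 = real n * \<rho>"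
  shows "measure_pmf.prob (random_graph n p) {X. 7 * real n * h \<le> (\<Sum>i<n. \<Sum>j<n. noise p X i j * s i * t j)}
    \<le> exp (- 5 * real n)"
proof -
  \<comment> \<open>The same scaling over all \<open>n\<close> rows gives a variance term of at most
    \<open>2 * n\<close>; with threshold \<open>7 * n\<close> the exponent is
    \<open>- 5 * n\<close>.\<close>
  define B where "B i j = s i * t j / h" for i j
  have st: "\<bar>s i * t j\<bar> \<le> 1" if "i < n" "j < n" for i j
    using s that by (simp add: abs_mult mult_le_one)
  have le: "\<bar>B i j\<bar> \<le> 1 / 2" if "i < n" "j < n" for i j
    using st[OF that] h(1) unfolding B_def by (auto simp: divide_le_eq)
  have "(\<Sum>i<n. \<Sum>j<n. B i j * noise p X i j) = (\<Sum>i<n. \<Sum>j<n. noise p X i j * s i * t j) / h" for X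
    by (simp add: B_def sum_divide_distrib mult_ac)
  then have set_eq: "{X. 7 * real n * h \<le> (\<Sum>i<n. \<Sum>j<n. noise p X i j * s i * t j)}
      = {X. 7 * real n \<le> (\<Sum>i<n. \<Sum>j<n. B i j * noise p X i j)}"
    using h(1) by (simp add: le_divide_eq)
  have "(\<Sum>i<n. \<Sum>j<n. (B i j)\<^sup>2) \<le> (\<Sum>i<n. \<Sum>j<n. 1 / h\<^sup>2)"
    using st by (intro sum_mono) (auto simp: B_def power_divide abs_square_le_1 intro!: divide_right_mono)
  also have "\<dots> = real n * (real n / h\<^sup>2)" by simp
  finally have "2 * \<rho> * (\<Sum>i<n. \<Sum>j<n. (B i j)\<^sup>2) \<le> 2 * \<rho> * (real n * (real n / h\<^sup>2))"
    using p[of undefined] by (intro mult_left_mono) auto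
  also have "\<dots> = 2 * real n * (real n * \<rho> / h\<^sup>2)" by simp
  also have "\<dots> = 2 * real n" using h(1) unfolding h(2)[symmetric] by simp
  finally have "exp (2 * \<rho> * (\<Sum>i<n. \<Sum>j<n. (B i j)\<^sup>2) - 7 * real n) \<le> exp (- 5 * real n)" by simp
  with noise_bilinear_tail[of B "7 * real n", OF le] show ?thesis unfolding set_eq by (rule order_trans)
qed

lemma noise_cut_tail:
  assumes h: "2 \<le> h" "h\<^sup>2 = real n * \<rho>"
  shows "measure_pmf.prob (random_graph n p)
      {X. \<exists>v w. (\<forall>i<n. \<bar>v i\<bar> \<le> 1) \<and> (\<forall>i<n. \<bar>w i\<bar> \<le> 1)
        \<and> 7 * real n * h < (\<Sum>i<n. \<Sum>j<n. noise p X i j * v i * w j)} \<le> exp (- 2 * real n)"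
    (is "measure_pmf.prob _ ?bad \<le> _")
proof -
  define V :: "(nat \<Rightarrow> real) set" where "V = {..<n} \<rightarrow>\<^sub>E {-1, 1}"
  let ?B = "\<lambda>(s, t). {X. 7 * real n * h \<le> (\<Sum>i<n. \<Sum>j<n. noise p X i j * s i * t j)}"
  have V: "finite V" "card V = 2 ^ n" unfolding V_def by (auto simp: card_PiE finite_PiE numeral_2_eq_2)
  have "?bad \<subseteq> (\<Union>st\<in>V \<times> V. ?B st)"
  proof
    fix X assume "X \<in> ?bad"
    then obtain v w where vw: "\<forall>i<n. \<bar>v i\<bar> \<le> 1" "\<forall>i<n. \<bar>w i\<bar> \<le> 1"
      and gt: "7 * real n * h < (\<Sum>i<n. \<Sum>j<n. noise p X i j * v i * w j)" by blast
    obtain s t where st: "\<forall>i. s i \<in> {-1, 1}" "\<forall>i. t i \<in> {-1, 1}"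
      and le: "(\<Sum>i<n. \<Sum>j<n. noise p X i j * v i * w j) \<le> (\<Sum>i<n. \<Sum>j<n. noise p X i j * s i * t j)"
      using ex_sign_vector_cut_max[OF vw, of "noise p X"] by blast
    \<comment> \<open>Restriction to \<open>{..<n}\<close> places the sign vectors in the finite set
      \<open>V\<close> without changing the form.\<close>
    let ?r = "\<lambda>f. restrict f {..<n}"
    have "(\<Sum>i<n. \<Sum>j<n. noise p X i j * s i * t j) = (\<Sum>i<n. \<Sum>j<n. noise p X i j * ?r s i * ?r t j)"
      by simp
    then have "X \<in> ?B (?r s, ?r t)" using gt le by simp
    moreover have "?r s \<in> V" "?r t \<in> V" using st by (auto simp: V_def)
    ultimately show "X \<in> (\<Union>st\<in>V \<times> V. ?B st)" by blast
  qed
  then have "measure_pmf.prob (random_graph n p) ?bad \<le> measure_pmf.prob (random_graph n p) (\<Union>st\<in>V \<times> V. ?B st)"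
    by (intro measure_pmf.finite_measure_mono) auto
  also have "\<dots> \<le> (\<Sum>st\<in>V \<times> V. measure_pmf.prob (random_graph n p) (?B st))"
    using V by (intro measure_pmf.finite_measure_subadditive_finite) auto
  also have "\<dots> \<le> (\<Sum>st\<in>V \<times> V. exp (- 5 * real n))"
  proof (rule sum_mono)
    fix st assume "st \<in> V \<times> V"
    then obtain s t where st: "st = (s, t)" "s \<in> V" "t \<in> V" by blast
    have "\<bar>f i\<bar> \<le> 1" if "f \<in> V" "i < n" for f i
      using PiE_mem[OF that(1)[unfolded V_def], of i] that(2) by auto
    then show "measure_pmf.prob (random_graph n p) (?B st) \<le> exp (- 5 * real n)"
      unfolding st(1) prod.case using st by (intro noise_cut_tail_single h) auto
  qed
  also have "\<dots> = 4 ^ n * exp (- 5 * real n)"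
    using V by (simp add: card_cartesian_product flip: power_mult_distrib)
  \<comment> \<open>The \<open>4 ^ n\<close> sign pairs cost at most \<open>exp (3 * n)\<close> of
    the available \<open>exp (- 5 * n)\<close>.\<close>
  also have "\<dots> \<le> exp 3 ^ n * exp (- 5 * real n)"
    using exp_ge_add_one_self[of 3] by (intro mult_right_mono power_mono) auto
  also have "\<dots> = exp (- 2 * real n)" by (simp flip: exp_of_nat_mult exp_add)
  finally show ?thesis .
qed

text \<open>A large row norm is reduced to a large row sum, because the entries nearly satisfy
  \<open>z\<^sup>2 = z\<close>. This leaves three one-sided events per row, with weights
  \<open>g\<close>, \<open>- g\<close> and 1.\<close>

lemma noise_rows_tail:
  assumes g: "\<And>i. i < n \<Longrightarrow> \<bar>g i\<bar> \<le> 1" and h: "2 \<le> h" "h\<^sup>2 = real n * \<rho>" and L: "L \<le> h"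
  shows "measure_pmf.prob (random_graph n p)
      {X. \<exists>i<n. L * h < \<bar>\<Sum>j<n. noise p X i j * g j\<bar> \<or> 3 * h\<^sup>2 < (\<Sum>j<n. (noise p X i j)\<^sup>2)}
    \<le> 3 * real n * exp (2 - L)" (is "measure_pmf.prob _ ?bad \<le> _")
proof -
  let ?B = "\<lambda>y i. {X. L * h \<le> (\<Sum>j<n. noise p X i j * y j)}"
  let ?U = "\<lambda>i. ?B g i \<union> ?B (\<lambda>j. - g j) i \<union> ?B (\<lambda>_. 1) i"
  let ?P = "measure_pmf.prob (random_graph n p)"
  have "?bad \<subseteq> (\<Union>i\<in>{..<n}. ?U i)"
  proof
    fix X assume "X \<in> ?bad"
    then obtain i where i: "i < n"
      and or: "L * h < \<bar>\<Sum>j<n. noise p X i j * g j\<bar> \<or> 3 * h\<^sup>2 < (\<Sum>j<n. (noise p X i j)\<^sup>2)" by blast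
    have sq: "(\<Sum>j<n. (noise p X i j)\<^sup>2) \<le> (\<Sum>j<n. noise p X i j) + 2 * h\<^sup>2"
    proof -
      have "(noise p X i j)\<^sup>2 \<le> noise p X i j + 2 * \<rho>" for j
      proof -
        let ?q = "p (edge i j)"
        have "?q * ?q \<le> ?q" "0 \<le> ?q" "?q \<le> \<rho>" using p[of "edge i j"] by (auto simp: mult_left_le)
        then show ?thesis by (cases "X (edge i j)") (auto simp: noise_def power2_eq_square algebra_simps)
      qed
      then have "(\<Sum>j<n. (noise p X i j)\<^sup>2) \<le> (\<Sum>j<n. noise p X i j + 2 * \<rho>)" by (intro sum_mono)
      also have "\<dots> = (\<Sum>j<n. noise p X i j) + 2 * h\<^sup>2" unfolding h(2) by (simp add: sum.distrib)
      finally show ?thesis .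
    qed
    \<comment> \<open>A row norm above \<open>3 * h\<^sup>2\<close> forces a row sum above
      \<open>h\<^sup>2\<close>, hence above \<open>L * h\<close>.\<close>
    have "L * h \<le> h\<^sup>2" using L h(1) by (simp add: power2_eq_square)
    with or sq have "L * h \<le> (\<Sum>j<n. noise p X i j * g j) \<or> L * h \<le> - (\<Sum>j<n. noise p X i j * g j)
        \<or> L * h \<le> (\<Sum>j<n. noise p X i j)" by linarith
    then have "X \<in> ?U i" by (simp add: sum_negf disj_assoc)
    with i show "X \<in> (\<Union>i\<in>{..<n}. ?U i)" by blast
  qed
  then have "?P ?bad \<le> ?P (\<Union>i\<in>{..<n}. ?U i)" by (intro measure_pmf.finite_measure_mono) auto
  also have "\<dots> \<le> (\<Sum>i<n. ?P (?U i))"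
    by (intro measure_pmf.finite_measure_subadditive_finite) auto
  also have "\<dots> \<le> (\<Sum>i<n. 3 * exp (2 - L))"
  proof (rule sum_mono)
    fix i assume "i \<in> {..<n}"
    then have i: "i < n" by simp
    have "?P (?U i) \<le> ?P (?B g i \<union> ?B (\<lambda>j. - g j) i) + ?P (?B (\<lambda>_. 1) i)"
      by (rule measure_Un_le) auto
    also have "\<dots> \<le> (?P (?B g i) + ?P (?B (\<lambda>j. - g j) i)) + ?P (?B (\<lambda>_. 1) i)"
      by (intro add_right_mono measure_Un_le) auto
    also have "\<dots> \<le> (exp (2 - L) + exp (2 - L)) + exp (2 - L)"
      using g by (intro add_mono noise_row_tail i h) auto
    finally show "?P (?U i) \<le> 3 * exp (2 - L)" by simp
  qed
  also have "\<dots> = 3 * real n * exp (2 - L)" by simp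
  finally show ?thesis .
qed

end

section \<open>Recovery in the stochastic block model\<close>

text \<open>Translates the matrix conditions into the sums used in the locale; \<open>S\<close> is
  the diagonal of \<open>ddiag (M * Q * transpose_mat Q)\<close>.\<close>

lemma second_order_critical_coordinates:
  assumes soc: "second_order_critical n M Q" and M: "M \<in> carrier_mat n n"
  defines "x \<equiv> \<lambda>i. Q $$ (i, 0)" and "y \<equiv> \<lambda>i. Q $$ (i, 1)"
  defines "S \<equiv> \<lambda>i. \<Sum>j<n. M $$ (i, j) * (x i * x j + y i * y j)"
  shows "\<And>i. i < n \<Longrightarrow> (x i)\<^sup>2 + (y i)\<^sup>2 = 1"
    and "\<And>i. i < n \<Longrightarrow> S i * x i = (\<Sum>j<n. M $$ (i, j) * x j)"
    and "\<And>i. i < n \<Longrightarrow> S i * y i = (\<Sum>j<n. M $$ (i, j) * y j)"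
    and "\<And>v. (\<Sum>i<n. \<Sum>j<n. M $$ (i, j) * (x i * x j + y i * y j) * v i * v j) \<le> (\<Sum>i<n. S i * (v i)\<^sup>2)"
    and "\<And>i j. i < n \<Longrightarrow> j < n \<Longrightarrow> (Q * transpose_mat Q) $$ (i, j) = x i * x j + y i * y j"
proof -
  have Q: "Q \<in> carrier_mat n 2" and row: "\<And>i. i < n \<Longrightarrow> row Q i \<bullet> row Q i = 1"
    and fo: "(ddiag (M * Q * transpose_mat Q) - M) * Q = 0\<^sub>m n 2"
    and so: "positive_semidefinite (ddiag (M * Q * transpose_mat Q) - hadamard M (Q * transpose_mat Q))"
    using soc unfolding second_order_critical_def feasible_def by auto
  have dims [simp]: "dim_row Q = n" "dim_col Q = 2" "dim_row M = n" "dim_col M = n" using Q M by auto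
  have two: "{0..<2} = {0, 1 :: nat}" by auto
  show "(x i)\<^sup>2 + (y i)\<^sup>2 = 1" if "i < n" for i
    using row[OF that] that by (simp add: scalar_prod_def two x_def y_def power2_eq_square)
  show QQ: "(Q * transpose_mat Q) $$ (i, j) = x i * x j + y i * y j" if "i < n" "j < n" for i j
    using that by (simp add: scalar_prod_def two x_def y_def)
  have MQ: "(M * Q) $$ (i, k) = (\<Sum>j<n. M $$ (i, j) * Q $$ (j, k))" if "i < n" "k < 2" for i k
    using that by (simp add: scalar_prod_def lessThan_atLeast0)
  define T where "T = ddiag (M * Q * transpose_mat Q)"
  have T: "T $$ (i, j) = (if i = j then S i else 0)" if "i < n" "j < n" for i j
  proof -
    have "(M * Q * transpose_mat Q) $$ (i, i) = (M * Q) $$ (i, 0) * x i + (M * Q) $$ (i, 1) * y i"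
      using that by (simp add: scalar_prod_def[of "row (M * Q) i"] two x_def y_def del: index_mult_mat(1))
        (subst index_mult_mat(1); simp add: scalar_prod_def[of "row (M * Q) i"] two del: index_mult_mat(1))
    also have "\<dots> = S i"
      using that by (simp add: MQ S_def x_def y_def sum_distrib_left distrib_left sum.distrib mult_ac del: index_mult_mat(1))
    finally show ?thesis using that unfolding T_def ddiag_def by (cases "i = j") (simp_all del: index_mult_mat(1))
  qed
  have Tdim [simp]: "dim_row T = n" "dim_col T = n" by (simp_all add: T_def ddiag_def)
  have fo': "S i * Q $$ (i, k) = (\<Sum>j<n. M $$ (i, j) * Q $$ (j, k))" if "i < n" "k < 2" for i k
  proof -
    have "0 = ((T - M) * Q) $$ (i, k)" using fo that by (simp add: T_def)
    also have "\<dots> = (\<Sum>j<n. (T $$ (i, j) - M $$ (i, j)) * Q $$ (j, k))"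
      using that by (simp add: scalar_prod_def lessThan_atLeast0)
    also have "\<dots> = (\<Sum>j<n. (if i = j then S i * Q $$ (j, k) else 0) - M $$ (i, j) * Q $$ (j, k))"
      using that by (intro sum.cong refl) (simp add: T left_diff_distrib)
    also have "\<dots> = S i * Q $$ (i, k) - (\<Sum>j<n. M $$ (i, j) * Q $$ (j, k))"
      using that by (simp add: sum_subtractf)
    finally show ?thesis by simp
  qed
  show "S i * x i = (\<Sum>j<n. M $$ (i, j) * x j)" "S i * y i = (\<Sum>j<n. M $$ (i, j) * y j)" if "i < n" for i
    unfolding x_def y_def using fo' that by auto
  show "(\<Sum>i<n. \<Sum>j<n. M $$ (i, j) * (x i * x j + y i * y j) * v i * v j) \<le> (\<Sum>i<n. S i * (v i)\<^sup>2)" for v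
  proof -
    let ?v = "Matrix.vec n v" and ?H = "T - hadamard M (Q * transpose_mat Q)"
    have Hdim [simp]: "dim_row ?H = n" "dim_col ?H = n" by (simp_all add: hadamard_def)
    have H: "?H $$ (i, j) = (if i = j then S i else 0) - M $$ (i, j) * (x i * x j + y i * y j)"
      if "i < n" "j < n" for i j
      using that T QQ by (simp add: hadamard_def del: index_mult_mat(1))
    have "0 \<le> ?v \<bullet> (?H *\<^sub>v ?v)"
      using so Hdim(1) unfolding positive_semidefinite_def T_def[symmetric] by (metis vec_carrier)
    also have "\<dots> = (\<Sum>i<n. v i * (\<Sum>j<n. ?H $$ (i, j) * v j))"
      by (simp add: scalar_prod_def lessThan_atLeast0 del: index_minus_mat)
    also have "\<dots> = (\<Sum>i<n. \<Sum>j<n. (if i = j then S i * (v i)\<^sup>2 else 0)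
        - M $$ (i, j) * (x i * x j + y i * y j) * v i * v j)"
      unfolding sum_distrib_left
      by (intro sum.cong refl) (simp add: H power2_eq_square algebra_simps del: index_minus_mat)
    also have "\<dots> = (\<Sum>i<n. S i * (v i)\<^sup>2) - (\<Sum>i<n. \<Sum>j<n. M $$ (i, j) * (x i * x j + y i * y j) * v i * v j)"
      by (simp add: sum_subtractf)
    finally show ?thesis by simp
  qed
qed

definition edge_prob :: "real Matrix.vec \<Rightarrow> real \<Rightarrow> real \<Rightarrow> nat \<times> nat \<Rightarrow> real" where
  "edge_prob g p q = (\<lambda>(i, j). if g $ i * g $ j = 1 then p else q)"

text \<open>Conjugation by the signs \<open>g\<close> turns the planted part \<open>a g g^T\<close>
  into the constant matrix \<open>a\<close> and preserves the noise bounds: the cube is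
  sign-invariant and Gram entries change only in sign. Ordinary row sums become
  \<open>g\<close>-weighted ones, which is why \<open>row_sum\<close> carries
  \<open>g\<close>.\<close>

lemma second_order_critical_eq_planted:
  fixes n :: nat and g :: "real Matrix.vec" and p q L h :: real and X :: "nat \<times> nat \<Rightarrow> bool"
  defines "A \<equiv> Matrix.mat n n (\<lambda>(i, j). of_bool (X (min i j, max i j)) :: real)"
  defines "a \<equiv> (p - q) / 2" and "W \<equiv> noise (edge_prob g p q) X"
  assumes soc: "second_order_critical n (centered_adjacency n p q A) Q"
    and g: "balanced_labels n g" and pq: "p \<le> 1" "q \<le> 1"
    and L: "L ^ 3 = real n" "1 \<le> L" and h: "0 < h"
    and snr: "1000 * L * h \<le> a * real n" and large: "2 \<le> a * real n"
    and cut: "\<And>v w. \<lbrakk>\<forall>i<n. \<bar>v i\<bar> \<le> 1; \<forall>i<n. \<bar>w i\<bar> \<le> 1\<rbrakk>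
      \<Longrightarrow> (\<Sum>i<n. \<Sum>j<n. W i j * v i * w j) \<le> 7 * real n * h"
    and row_sum: "\<And>i. i < n \<Longrightarrow> \<bar>\<Sum>j<n. W i j * g $ j\<bar> \<le> L * h"
    and row_norm: "\<And>i. i < n \<Longrightarrow> (\<Sum>j<n. (W i j)\<^sup>2) \<le> 3 * h\<^sup>2"
    and gram: "(\<Sum>i<n. \<Sum>k\<in>{..<n}-{i}. (\<Sum>j<n. W i j * W k j)\<^sup>2) \<le> (L\<^sup>2 * h\<^sup>2)\<^sup>2"
  shows "Q * transpose_mat Q = outer_prod g g"
proof -
  let ?M = "centered_adjacency n p q A"
  have Mc: "?M \<in> carrier_mat n n"
    unfolding centered_adjacency_def outer_prod_def ones_vec_def A_def by auto
  have gn: "dim_vec g = n" and g1: "g $ i = 1 \<or> g $ i = -1" if "i < n" for i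
    using g that unfolding balanced_labels_def by auto
  have gg: "g $ i * g $ i = 1" and gsq: "(g $ i)\<^sup>2 = 1" if "i < n" for i using g1[OF that] by auto
  have gabs: "\<bar>g $ i\<bar> = 1" if "i < n" for i using g1[OF that] by auto
  have M: "?M $$ (i, j) = W i j + a * (g $ i * g $ j)" if "i < n" "j < n" for i j
  proof -
    have "?M $$ (i, j) = of_bool (X (edge i j)) - (p + q) / 2"
      using that unfolding centered_adjacency_def outer_prod_def ones_vec_def A_def edge_def by simp
    \<comment> \<open>\<open>p\<close> and \<open>q\<close> are the midpoint
      \<open>(p + q) / 2\<close> plus and minus \<open>a\<close>.\<close>
    moreover have "edge_prob g p q (edge i j) = (p + q) / 2 + a * (g $ i * g $ j)"
      using g1[OF that(1)] g1[OF that(2)]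
      unfolding edge_prob_def edge_def a_def min_def max_def by (auto simp: field_simps)
    ultimately show ?thesis unfolding W_def noise_def by simp
  qed
  define x where "x i = Q $$ (i, 0)" for i
  define y where "y i = Q $$ (i, 1)" for i
  define S where "S i = (\<Sum>j<n. ?M $$ (i, j) * (x i * x j + y i * y j))" for i
  note crit = second_order_critical_coordinates[OF soc Mc, folded x_def y_def, folded S_def]
  define W' where "W' i j = g $ i * g $ j * W i j" for i j
  have MW: "a + W' i j = g $ i * g $ j * ?M $$ (i, j)" if "i < n" "j < n" for i j
    using g1[OF that(1)] g1[OF that(2)] unfolding M[OF that] W'_def by auto
  have X: "(a + W' i j) * (g $ i * x i * (g $ j * x j) + g $ i * y i * (g $ j * y j))
      = ?M $$ (i, j) * (x i * x j + y i * y j)" if "i < n" "j < n" for i j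
    using g1[OF that(1)] g1[OF that(2)] unfolding MW[OF that] by (auto simp: algebra_simps)
  interpret planted_critical_point n a h L "real n" W' "\<lambda>i. g $ i * x i" "\<lambda>i. g $ i * y i" S
  proof
    show "W' i j = W' j i" for i j
      unfolding W'_def W_def noise_def edge_def by (simp add: min.commute max.commute)
    show "(\<Sum>i<n. \<Sum>j<n. W' i j * v i * w j) \<le> 7 * real n * h"
      if "\<forall>i<n. \<bar>v i\<bar> \<le> 1" "\<forall>i<n. \<bar>w i\<bar> \<le> 1" for v w
    proof -
      have "(\<Sum>i<n. \<Sum>j<n. W' i j * v i * w j) = (\<Sum>i<n. \<Sum>j<n. W i j * (g $ i * v i) * (g $ j * w j))"
        unfolding W'_def by (simp add: mult_ac)
      also have "\<dots> \<le> 7 * real n * h" using that gabs by (intro cut) (auto simp: abs_mult)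
      finally show ?thesis .
    qed
    show "\<bar>\<Sum>j<n. W' i j\<bar> \<le> L * h" if "i < n" for i
    proof -
      have "(\<Sum>j<n. W' i j) = g $ i * (\<Sum>j<n. W i j * g $ j)"
        unfolding W'_def by (simp add: sum_distrib_left mult_ac)
      then show ?thesis using row_sum[OF that] gabs[OF that] by (simp add: abs_mult)
    qed
    show "(\<Sum>j<n. (W' i j)\<^sup>2) \<le> 3 * h\<^sup>2" if "i < n" for i
    proof -
      have "(\<Sum>j<n. (W' i j)\<^sup>2) = (\<Sum>j<n. (W i j)\<^sup>2)"
        using that by (intro sum.cong refl) (simp add: W'_def power_mult_distrib gsq)
      then show ?thesis using row_norm[OF that] by simp
    qed
    have "(\<Sum>i<n. \<Sum>k\<in>{..<n}-{i}. (\<Sum>j<n. W' i j * W' k j)\<^sup>2)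
        = (\<Sum>i<n. \<Sum>k\<in>{..<n}-{i}. (\<Sum>j<n. W i j * W k j)\<^sup>2)"
    proof (intro sum.cong refl)
      fix i k assume ik: "i \<in> {..<n}" "k \<in> {..<n} - {i}"
      have "(\<Sum>j<n. W' i j * W' k j) = (\<Sum>j<n. g $ i * g $ k * (W i j * W k j))"
      proof (intro sum.cong refl)
        fix j assume "j \<in> {..<n}"
        have "W' i j * W' k j = g $ i * g $ k * (W i j * W k j) * (g $ j * g $ j)"
          by (simp add: W'_def mult_ac)
        then show "W' i j * W' k j = g $ i * g $ k * (W i j * W k j)"
          using gg[of j] \<open>j \<in> {..<n}\<close> by simp
      qed
      also have "\<dots> = g $ i * g $ k * (\<Sum>j<n. W i j * W k j)" by (simp add: sum_distrib_left)
      finally show "(\<Sum>j<n. W' i j * W' k j)\<^sup>2 = (\<Sum>j<n. W i j * W k j)\<^sup>2"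
        using g1[of i] g1[of k] ik by auto
    qed
    then show "(\<Sum>i<n. \<Sum>k\<in>{..<n}-{i}. (\<Sum>j<n. W' i j * W' k j)\<^sup>2) \<le> (L\<^sup>2 * h\<^sup>2)\<^sup>2"
      using gram by simp
    show "-1 \<le> a + W' i i" if "i < n" for i
    proof -
      have "?M $$ (i, i) = of_bool (X (i, i)) - (p + q) / 2"
        using that unfolding centered_adjacency_def outer_prod_def ones_vec_def A_def by simp
      then show ?thesis unfolding MW[OF that that] gg[OF that] using pq by (cases "X (i, i)") auto
    qed
    show "(g $ i * x i)\<^sup>2 + (g $ i * y i)\<^sup>2 = 1" if "i < n" for i
      using crit(1)[OF that] g1[OF that] by auto
    show "S i = (\<Sum>j<n. (a + W' i j) * (g $ i * x i * (g $ j * x j) + g $ i * y i * (g $ j * y j)))"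
      if "i < n" for i
      unfolding S_def using that X by (intro sum.cong refl) simp
    have conj: "(\<Sum>j<n. (a + W' i j) * (g $ j * z j)) = g $ i * (\<Sum>j<n. ?M $$ (i, j) * z j)" if "i < n" for i z
      unfolding sum_distrib_left
    proof (intro sum.cong refl)
      fix j assume "j \<in> {..<n}"
      then have j: "j < n" by simp
      show "(a + W' i j) * (g $ j * z j) = g $ i * (?M $$ (i, j) * z j)"
        using g1[OF j] unfolding MW[OF that j] by auto
    qed
    show "S i * (g $ i * x i) = (\<Sum>j<n. (a + W' i j) * (g $ j * x j))"
      "S i * (g $ i * y i) = (\<Sum>j<n. (a + W' i j) * (g $ j * y j))" if "i < n" for i
      unfolding conj[OF that] crit(2,3)[OF that, symmetric] by simp_all
    show "(\<Sum>i<n. \<Sum>j<n. (a + W' i j) * (g $ i * x i * (g $ j * x j) + g $ i * y i * (g $ j * y j)) * v i * v j)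
      \<le> (\<Sum>i<n. S i * (v i)\<^sup>2)" for v
    proof -
      have "(\<Sum>i<n. \<Sum>j<n. (a + W' i j) * (g $ i * x i * (g $ j * x j) + g $ i * y i * (g $ j * y j)) * v i * v j)
        = (\<Sum>i<n. \<Sum>j<n. ?M $$ (i, j) * (x i * x j + y i * y j) * v i * v j)"
        using X by (intro sum.cong refl) simp
      then show ?thesis using crit(4)[of v] by simp
    qed
  qed (use L h snr large in simp_all)
  have "x i * x j + y i * y j = g $ i * g $ j" if "i < n" "j < n" for i j
    using inner_eq_1[OF that] g1[OF that(1)] g1[OF that(2)] by auto
  then show ?thesis
    using crit(5) soc g unfolding second_order_critical_def feasible_def balanced_labels_def outer_prod_def
    by (intro eq_matI) auto
qed

section \<open>Union bound and the limit\<close>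

lemma sbm_eq_map_random_graph:
  "sbm n g p q = map_pmf (\<lambda>X. Matrix.mat n n (\<lambda>(i, j). of_bool (X (min i j, max i j))))
    (random_graph n (edge_prob g p q))"
proof -
  have "(\<lambda>(i, j). bernoulli_pmf (if g $ i * g $ j = 1 then p else q)) = (\<lambda>e. bernoulli_pmf (edge_prob g p q e))"
    by (auto simp: edge_prob_def)
  then show ?thesis unfolding sbm_def edges_def by simp
qed

text \<open>Union bound over a large cut form, a bad row and a large Gram matrix. The last,
  controlled only by Markov's inequality, gives the asymptotically dominant
  \<open>1 / L\<close>.\<close>

lemma sbm_recovery_prob:
  fixes n :: nat and p q :: real
  defines "L \<equiv> real n powr (1 / 3)"
  assumes g: "balanced_labels n g" and pq: "0 \<le> q" "q < p" "p \<le> 1" and n: "0 < n"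
    and snr: "2000 * L \<le> sbm_snr n p q"
  shows "1 - (exp (- 2 * real n) + 3 * real n * exp (2 - L) + 1 / L)
    \<le> measure_pmf.prob (sbm n g p q)
        {A. \<forall>Q. second_order_critical n (centered_adjacency n p q A) Q \<longrightarrow> Q * transpose_mat Q = outer_prod g g}"
    (is "_ \<le> measure_pmf.prob _ ?good")
proof -
  define \<rho> where "\<rho> = p + q"
  define h where "h = sqrt (real n * \<rho>)"
  define a where "a = (p - q) / 2"
  have L3: "L ^ 3 = real n" using n by (simp add: L_def powr_power)
  have L1: "1 \<le> L" using n by (simp add: L_def ge_one_powr_ge_zero)
  have \<rho>: "0 < \<rho>" using pq by (simp add: \<rho>_def)
  have h0: "0 < h" and h2: "h\<^sup>2 = real n * \<rho>" using n \<rho> by (auto simp: h_def)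
  have snr': "1000 * L * h \<le> a * real n"
  proof -
    have "2000 * L \<le> (p - q) / sqrt (2 * \<rho>) * sqrt n" using snr by (simp add: sbm_snr_def \<rho>_def)
    \<comment> \<open>Drops the factor \<open>sqrt 2\<close>; the constant 2000 becomes 1000 because
      \<open>a\<close> is half of \<open>p - q\<close>.\<close>
    also have "\<dots> \<le> (p - q) / sqrt \<rho> * sqrt n"
      using pq \<rho> by (intro mult_right_mono divide_left_mono) auto
    finally have "2000 * L * sqrt \<rho> \<le> (p - q) * sqrt n"
      using \<rho> by (simp add: field_simps)
    then have "2000 * L * sqrt \<rho> * sqrt n \<le> (p - q) * sqrt n * sqrt n" by (rule mult_right_mono) simp
    then show ?thesis by (simp add: h_def a_def real_sqrt_mult mult_ac)
  qed
  have hL: "2000 * L \<le> h"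
  proof -
    \<comment> \<open>The signal cannot exceed the density, so strong signal forces a large
      \<open>h\<close>; this supplies \<open>2 \<le> h\<close> and \<open>L \<le> h\<close>.\<close>
    have "a * real n \<le> \<rho> / 2 * real n" using pq by (intro mult_right_mono) (auto simp: a_def \<rho>_def)
    then have "2000 * L * h \<le> h * h" using snr' h2 by (simp add: power2_eq_square mult_ac)
    then show ?thesis using h0 by simp
  qed
  have "1000 * 1 * 1 \<le> 1000 * L * h" using L1 hL by (intro mult_mono) auto
  then have large: "2 \<le> a * real n" using snr' by linarith
  have ep: "0 \<le> edge_prob g p q e \<and> edge_prob g p q e \<le> 1 \<and> edge_prob g p q e \<le> \<rho>" for e
    using pq by (auto simp: edge_prob_def \<rho>_def split: prod.split)
  have gabs: "\<bar>g $ i\<bar> \<le> 1" if "i < n" for i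
    using g that by (auto simp: balanced_labels_def)
  let ?W = "\<lambda>X. noise (edge_prob g p q) X"
  let ?P = "measure_pmf.prob (random_graph n (edge_prob g p q))"
  define B1 where "B1 = {X. \<exists>v w. (\<forall>i<n. \<bar>v i\<bar> \<le> 1) \<and> (\<forall>i<n. \<bar>w i\<bar> \<le> 1)
        \<and> 7 * real n * h < (\<Sum>i<n. \<Sum>j<n. ?W X i j * v i * w j)}"
  define B2 where "B2 = {X. \<exists>i<n. L * h < \<bar>\<Sum>j<n. ?W X i j * g $ j\<bar> \<or> 3 * h\<^sup>2 < (\<Sum>j<n. (?W X i j)\<^sup>2)}"
  define B3 where "B3 = {X. (L\<^sup>2 * h\<^sup>2)\<^sup>2 \<le> (\<Sum>i<n. \<Sum>k\<in>{..<n}-{i}. (\<Sum>j<n. ?W X i j * ?W X k j)\<^sup>2)}"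
  have h2': "2 \<le> h" "L \<le> h" using hL L1 by auto
  have "?P B1 \<le> exp (- 2 * real n)"
    unfolding B1_def by (rule noise_cut_tail[OF ep h2'(1) h2])
  moreover have "?P B2 \<le> 3 * real n * exp (2 - L)"
    unfolding B2_def using noise_rows_tail[OF ep gabs h2'(1) h2 h2'(2)] by simp
  moreover have "?P B3 \<le> 1 / L"
  proof -
    have "?P B3 \<le> real n ^ 3 * \<rho>\<^sup>2 / (L\<^sup>2 * h\<^sup>2)\<^sup>2"
      unfolding B3_def using L1 h0 by (intro noise_gram_tail[OF ep]) simp
    \<comment> \<open>Both \<open>\<rho>\<^sup>2\<close> and two powers of \<open>n\<close> cancel,
      so the Gram estimate is uniform in the density.\<close>
    also have "\<dots> = real n / (L * L ^ 3)"
      unfolding h2 using n \<rho> L1 by (simp add: power2_eq_square power3_eq_cube field_simps)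
    also have "\<dots> = 1 / L" using n by (simp add: L3)
    finally show ?thesis .
  qed
  moreover have "?P (B1 \<union> B2 \<union> B3) \<le> (?P B1 + ?P B2) + ?P B3"
    by (intro order_trans[OF measure_Un_le] add_right_mono measure_Un_le) auto
  ultimately have bad: "?P (B1 \<union> B2 \<union> B3) \<le> exp (- 2 * real n) + 3 * real n * exp (2 - L) + 1 / L"
    by linarith
  have "- (B1 \<union> B2 \<union> B3) \<subseteq> (\<lambda>X. Matrix.mat n n (\<lambda>(i, j). of_bool (X (min i j, max i j)))) -` ?good"
  proof
    fix X assume X: "X \<in> - (B1 \<union> B2 \<union> B3)"
    have "Q * transpose_mat Q = outer_prod g g"
      if "second_order_critical n (centered_adjacency n p q
        (Matrix.mat n n (\<lambda>(i, j). of_bool (X (min i j, max i j))))) Q" for Q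
    proof (rule second_order_critical_eq_planted[OF that g])
      show "1000 * L * h \<le> (p - q) / 2 * real n" "2 \<le> (p - q) / 2 * real n"
        using snr' large by (simp_all add: a_def)
      show "(\<Sum>i<n. \<Sum>j<n. ?W X i j * v i * w j) \<le> 7 * real n * h"
        if "\<forall>i<n. \<bar>v i\<bar> \<le> 1" "\<forall>i<n. \<bar>w i\<bar> \<le> 1" for v w
        using X that unfolding B1_def by (force simp: not_less)
      show "\<bar>\<Sum>j<n. ?W X i j * g $ j\<bar> \<le> L * h" "(\<Sum>j<n. (?W X i j)\<^sup>2) \<le> 3 * h\<^sup>2" if "i < n" for i
        using X that unfolding B2_def by (auto simp: not_less dest!: spec[of _ i])
      show "(\<Sum>i<n. \<Sum>k\<in>{..<n}-{i}. (\<Sum>j<n. ?W X i j * ?W X k j)\<^sup>2) \<le> (L\<^sup>2 * h\<^sup>2)\<^sup>2"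
        using X unfolding B3_def by auto
    qed (use pq L3 L1 h0 in auto)
    then show "X \<in> (\<lambda>X. Matrix.mat n n (\<lambda>(i, j). of_bool (X (min i j, max i j)))) -` ?good" by simp
  qed
  then have "?P (- (B1 \<union> B2 \<union> B3)) \<le> measure_pmf.prob (sbm n g p q) ?good"
    unfolding sbm_eq_map_random_graph measure_map_pmf by (intro measure_pmf.finite_measure_mono) auto
  moreover have "?P (- (B1 \<union> B2 \<union> B3)) = 1 - ?P (B1 \<union> B2 \<union> B3)"
    using measure_pmf.prob_compl[of "B1 \<union> B2 \<union> B3"] by (simp add: Compl_eq_Diff_UNIV)
  ultimately show ?thesis using bad by linarith
qed

theorem theorem6:
  shows "\<exists>c::real. c > 0 \<and>
    (\<forall>(g :: nat \<Rightarrow> real Matrix.vec) (p :: nat \<Rightarrow> real) (q :: nat \<Rightarrow> real).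
      (\<forall>n>0. even n \<longrightarrow> balanced_labels n (g n) \<and> 0 \<le> q n \<and> q n < p n \<and> p n \<le> 1) \<longrightarrow>
      (\<forall>\<^sub>F m in sequentially.
         sbm_snr (2 * m) (p (2 * m)) (q (2 * m)) \<ge> c * real (2 * m) powr (1 / 3)) \<longrightarrow>
      (\<lambda>m. let n = 2 * m in
         measure_pmf.prob (sbm n (g n) (p n) (q n))
           {A. \<forall>Q. second_order_critical n (centered_adjacency n (p n) (q n) A) Q \<longrightarrow>
                 Q * transpose_mat Q = outer_prod (g n) (g n)}) \<longlonglongrightarrow> 1)"
proof (intro exI[of _ 2000] conjI allI impI)
  fix g :: "nat \<Rightarrow> real Matrix.vec" and p q :: "nat \<Rightarrow> real"
  assume model: "\<forall>n>0. even n \<longrightarrow> balanced_labels n (g n) \<and> 0 \<le> q n \<and> q n < p n \<and> p n \<le> 1"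
    and snr: "\<forall>\<^sub>F m in sequentially. sbm_snr (2 * m) (p (2 * m)) (q (2 * m)) \<ge> 2000 * real (2 * m) powr (1 / 3)"
  let ?good = "\<lambda>m. measure_pmf.prob (sbm (2 * m) (g (2 * m)) (p (2 * m)) (q (2 * m)))
    {A. \<forall>Q. second_order_critical (2 * m) (centered_adjacency (2 * m) (p (2 * m)) (q (2 * m)) A) Q \<longrightarrow>
      Q * transpose_mat Q = outer_prod (g (2 * m)) (g (2 * m))}"
  let ?lower = "\<lambda>n::nat. 1 - (exp (- 2 * real n)
    + 3 * real n * exp (2 - real n powr (1 / 3)) + 1 / real n powr (1 / 3))"
  have "?good \<longlonglongrightarrow> 1"
  \<comment> \<open>The lower bound depends only on \<open>n\<close>, so arbitrary sequences
    \<open>g\<close>, \<open>p\<close>, \<open>q\<close> are allowed.\<close>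
  proof (rule tendsto_sandwich)
    show "\<forall>\<^sub>F m in sequentially. ?lower (2 * m) \<le> ?good m"
      using snr eventually_gt_at_top[of 0]
    proof eventually_elim
      case (elim m)
      then show ?case using model[rule_format, of "2 * m"] by (intro sbm_recovery_prob) auto
    qed
    show "\<forall>\<^sub>F m in sequentially. ?good m \<le> 1" by simp
    \<comment> \<open>The stretched exponential in \<open>n powr (1 / 3)\<close> beats the factor
      \<open>n\<close> from the union over rows.\<close>
    have "?lower \<longlonglongrightarrow> 1" by real_asymp
    then show "(\<lambda>m. ?lower (2 * m)) \<longlonglongrightarrow> 1"
      by (rule LIMSEQ_subseq_LIMSEQ[unfolded o_def]) (simp add: strict_mono_def)
  qed simp
  then show "(\<lambda>m. let n = 2 * m in
         measure_pmf.prob (sbm n (g n) (p n) (q n))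
           {A. \<forall>Q. second_order_critical n (centered_adjacency n (p n) (q n) A) Q \<longrightarrow>
                 Q * transpose_mat Q = outer_prod (g n) (g n)}) \<longlonglongrightarrow> 1"
    by (simp only: Let_def)
qed simp

end
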